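(* Let $\alpha\in\ell^{1,\infty}_{++}$. Then the identities $$\int_0^\infty \xi_\alpha(\lambda)\,d\lambda = \sum_{n=0}^\infty \alpha_n^2$$ and $$\frac2\pi \int_0^\infty \left\{1-\exp\left(-\int_0^\infty \frac{\xi_\alpha(\lambda)}{\lambda+t^2}\,d\lambda\right)\right\}dt=\alpha_0$$ hold true.
   Context: Let $\ell^2=\ell^2(\mathbb{Z}_+)$, $\mathbb{Z}_+=\{0,1,2,\dots\}$. For a sequence $\alpha=\{\alpha_n\}_{n=0}^\infty$, the Hankel operator $\Gamma_\alpha$ in $\ell^2$ is $(\Gamma_\alpha x)_n=\sum_{m=0}^\infty\alpha_{n+m}x_m$. $S^*\alpha$ denotes the shifted sequence $\{\alpha_{n+1}\}_{n=0}^\infty$, so $\Gamma_{S^*\alpha}$ has matrix entries $\alpha_{n+m+1}$. All sequences $\alpha$ defining Hankel operators are assumed real-valued. $\ell^{1,\infty}$ is the set of sequences $x=\{x_n\}_{n\ge0}$ of complex numbers with $\|x\|_{\ell^{1,\infty}}=\sup_{n\geq0}(n+1)|x_n|<\infty$. If $\alpha\in\ell^{1,\infty}$ then $\Gamma_\alpha$ and $\Gamma_{S^*\alpha}$ are bounded on $\ell^2$. $\ell^{1,\infty}_{++}$ is the class of all $\alpha\in\ell^{1,\infty}$ such that $\Gamma_\alpha\geq0$ and $\Gamma_{S^*\alpha}\geq0$ (positivity in the quadratic form sense: $(\Gamma x,x)\ge0$ for all $x\in\ell^2$). Spectral shift function: if $A,B$ are bounded self-adjoint operators in a Hilbert space with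 $B-A$ trace class, then $\xi(\cdot;B,A)$ is the unique (up to a.e. equality) real-valued function in $L^1(\mathbb{R})$ such that $\mathrm{Tr}(\varphi(B)-\varphi(A))=\int_{-\infty}^\infty\xi(\lambda;B,A)\varphi'(\lambda)\,d\lambda$ for all $\varphi\in C_0^\infty(\mathbb{R})$. For $\alpha\in\ell^{1,\infty}_{++}$ one has $\Gamma_{S^*\alpha}^2=\Gamma_\alpha^2-(\cdot,\alpha)\alpha$ (a rank one perturbation), and one sets $\xi_\alpha(\lambda)=\xi(\lambda;\Gamma_\alpha^2,\Gamma_{S^*\alpha}^2)$; it takes values in $[0,1]$ and is supported in $[0,\|\Gamma_\alpha\|^2]$. *)

theory Defs
  imports "HOL-Analysis.Analysis"
begin

section \<open>The complex Hilbert space of square-summable sequences\<close>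

text \<open>
  The type below is the complex Hilbert space of square-summable complex sequences. As the library
  has no class of complex inner product spaces, its type-class structure is the underlying real
  Hilbert space (the real inner product is the real part of the complex one); the complex inner
  product is \<open>cinner\<close>.
\<close>

definition sq_summable :: "(nat \<Rightarrow> complex) \<Rightarrow> bool" where
  "sq_summable x \<longleftrightarrow> summable (\<lambda>n. (norm (x n))\<^sup>2)"

lemma sq_summable_add:
  assumes "sq_summable x" "sq_summable y"
  shows "sq_summable (\<lambda>n. x n + y n)"
proof -
  have "summable (\<lambda>n. 2 * (norm (x n))\<^sup>2 + 2 * (norm (y n))\<^sup>2)"
    using assms unfolding sq_summable_def by (intro summable_add summable_mult)
  moreover have "norm ((norm (x n + y n))\<^sup>2) \<le> 2 * (norm (x n))\<^sup>2 + 2 * (norm (y n))\<^sup>2" for n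
  proof -
    have "(norm (x n + y n))\<^sup>2 \<le> (norm (x n) + norm (y n))\<^sup>2"
      by (simp add: norm_triangle_ineq power_mono)
    also have "\<dots> \<le> 2 * (norm (x n))\<^sup>2 + 2 * (norm (y n))\<^sup>2"
      using zero_le_power2[of "norm (x n) - norm (y n)"]
      by (simp add: power2_sum power2_diff)
    finally show ?thesis by simp
  qed
  ultimately show ?thesis
    unfolding sq_summable_def by (rule summable_comparison_test'[where N = 0])
qed

lemma sq_summable_scaleR:
  "sq_summable x \<Longrightarrow> sq_summable (\<lambda>n. c *\<^sub>R x n)"
  unfolding sq_summable_def by (simp add: power_mult_distrib summable_mult)

typedef ell2 = "{x. sq_summable x}"
  morphisms ell2_nth Abs_ell2
  by (rule exI[of _ "\<lambda>_. 0"]) (simp add: sq_summable_def)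

setup_lifting type_definition_ell2

lemma ell2_eqI: "(\<And>n. ell2_nth x n = ell2_nth y n) \<Longrightarrow> x = y"
  by (metis ell2_nth_inject ext)

lemma summable_ell2: "summable (\<lambda>n. (norm (ell2_nth x n))\<^sup>2)"
  using ell2_nth[of x] by (simp add: sq_summable_def)

lemma abs_summable_ell2_prod: "summable (\<lambda>n. norm (ell2_nth x n) * norm (ell2_nth y n))"
proof -
  have "summable (\<lambda>n. (norm (ell2_nth x n))\<^sup>2 + (norm (ell2_nth y n))\<^sup>2)"
    by (intro summable_add summable_ell2)
  then show ?thesis
  proof (rule summable_comparison_test'[where N = 0])
    fix n
    have "2 * norm (ell2_nth x n) * norm (ell2_nth y n)
        \<le> (norm (ell2_nth x n))\<^sup>2 + (norm (ell2_nth y n))\<^sup>2"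
      by (rule sum_squares_bound)
    moreover have "0 \<le> norm (ell2_nth x n) * norm (ell2_nth y n)"
      by simp
    ultimately show "norm (norm (ell2_nth x n) * norm (ell2_nth y n))
        \<le> (norm (ell2_nth x n))\<^sup>2 + (norm (ell2_nth y n))\<^sup>2"
      unfolding real_norm_def by linarith
  qed
qed

lemma summable_ell2_prod: "summable (\<lambda>n. ell2_nth x n * cnj (ell2_nth y n))"
  by (rule summable_norm_cancel) (simp add: norm_mult abs_summable_ell2_prod)

lemma summable_ell2_inner: "summable (\<lambda>n. inner (ell2_nth x n) (ell2_nth y n))"
proof (rule summable_comparison_test'[OF abs_summable_ell2_prod[of x y], where N = 0])
  show "norm (inner (ell2_nth x n) (ell2_nth y n)) \<le> norm (ell2_nth x n) * norm (ell2_nth y n)" for n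
    using Cauchy_Schwarz_ineq2 by simp
qed

instantiation ell2 :: real_vector
begin

lift_definition zero_ell2 :: ell2 is "\<lambda>_. 0"
  by (simp add: sq_summable_def)

lift_definition plus_ell2 :: "ell2 \<Rightarrow> ell2 \<Rightarrow> ell2" is "\<lambda>x y n. x n + y n"
  by (rule sq_summable_add)

lift_definition scaleR_ell2 :: "real \<Rightarrow> ell2 \<Rightarrow> ell2" is "\<lambda>c x n. c *\<^sub>R x n"
  by (rule sq_summable_scaleR)

lift_definition uminus_ell2 :: "ell2 \<Rightarrow> ell2" is "\<lambda>x n. - x n"
  by (simp add: sq_summable_def)

lift_definition minus_ell2 :: "ell2 \<Rightarrow> ell2 \<Rightarrow> ell2" is "\<lambda>x y n. x n - y n"
  using sq_summable_add[of _ "\<lambda>n. - _ n"] by (simp add: sq_summable_def)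

instance
  by standard (transfer; simp add: algebra_simps)+

end

instantiation ell2 :: real_inner
begin

definition inner_ell2 :: "ell2 \<Rightarrow> ell2 \<Rightarrow> real" where
  "inner_ell2 x y = (\<Sum>n. inner (ell2_nth x n) (ell2_nth y n))"

definition norm_ell2 :: "ell2 \<Rightarrow> real" where
  "norm_ell2 x = sqrt (inner x x)"

definition sgn_ell2 :: "ell2 \<Rightarrow> ell2" where
  "sgn_ell2 x = x /\<^sub>R norm x"

definition dist_ell2 :: "ell2 \<Rightarrow> ell2 \<Rightarrow> real" where
  "dist_ell2 x y = norm (x - y)"

definition uniformity_ell2 :: "(ell2 \<times> ell2) filter" where
  "uniformity_ell2 = (INF e\<in>{0<..}. principal {(x, y). dist x y < e})"

definition open_ell2 :: "ell2 set \<Rightarrow> bool" where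
  "open_ell2 U \<longleftrightarrow> (\<forall>x\<in>U. eventually (\<lambda>(x', y). x' = x \<longrightarrow> y \<in> U) uniformity)"

instance
proof
  fix x y z :: ell2 and r :: real
  show "inner x y = inner y x"
    by (simp add: inner_ell2_def inner_commute)
  show "inner (x + y) z = inner x z + inner y z"
    by (simp add: inner_ell2_def plus_ell2.rep_eq inner_add_left suminf_add summable_ell2_inner)
  show "inner (r *\<^sub>R x) y = r * inner x y"
    by (simp add: inner_ell2_def scaleR_ell2.rep_eq suminf_mult summable_ell2_inner)
  show "0 \<le> inner x x"
    by (simp add: inner_ell2_def suminf_nonneg summable_ell2_inner)
  show "inner x x = 0 \<longleftrightarrow> x = 0"
  proof
    assume "inner x x = 0"
    then have "\<forall>n. inner (ell2_nth x n) (ell2_nth x n) = 0"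
      unfolding inner_ell2_def by (subst (asm) suminf_eq_zero_iff) (auto simp: summable_ell2_inner)
    then show "x = 0"
      by (intro ell2_eqI) (simp add: zero_ell2.rep_eq)
  qed (simp add: inner_ell2_def zero_ell2.rep_eq)
qed (simp_all only: norm_ell2_def sgn_ell2_def dist_ell2_def uniformity_ell2_def open_ell2_def)

end

lemma norm_ell2_sq: "(norm (x::ell2))\<^sup>2 = (\<Sum>n. (norm (ell2_nth x n))\<^sup>2)"
  by (simp add: power2_norm_eq_inner inner_ell2_def)

lemma norm_ell2_nth_le: "norm (ell2_nth x n) \<le> norm x"
proof -
  have "(norm (ell2_nth x n))\<^sup>2 \<le> (norm x)\<^sup>2"
    unfolding norm_ell2_sq using sum_le_suminf[OF summable_ell2, of "{n}" x] by simp
  then show ?thesis by (rule power2_le_imp_le) simp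
qed

lemma ell2_partial_sum_le: "(\<Sum>n<N. (norm (ell2_nth x n))\<^sup>2) \<le> (norm x)\<^sup>2"
  unfolding norm_ell2_sq by (rule sum_le_suminf[OF summable_ell2]) auto

instance ell2 :: complete_space
proof
  fix X :: "nat \<Rightarrow> ell2"
  assume X: "Cauchy X"
  have "Cauchy (\<lambda>k. ell2_nth (X k) n)" for n
  proof (rule CauchyI)
    fix e :: real
    assume "0 < e"
    then obtain M where M: "\<And>i j. i \<ge> M \<Longrightarrow> j \<ge> M \<Longrightarrow> norm (X i - X j) < e"
      using CauchyD[OF X] by blast
    have "norm (ell2_nth (X i) n - ell2_nth (X j) n) \<le> norm (X i - X j)" for i j
      using norm_ell2_nth_le[of "X i - X j" n] by (simp add: minus_ell2.rep_eq)
    then show "\<exists>M. \<forall>i\<ge>M. \<forall>j\<ge>M. norm (ell2_nth (X i) n - ell2_nth (X j) n) < e"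
      using M by (meson le_less_trans)
  qed
  then have "\<forall>n. \<exists>l. (\<lambda>k. ell2_nth (X k) n) \<longlonglongrightarrow> l"
    by (simp add: Cauchy_convergent_iff convergent_def)
  then obtain l where l: "\<And>n. (\<lambda>k. ell2_nth (X k) n) \<longlonglongrightarrow> l n"
    by metis
  have key: "\<exists>M. \<forall>k\<ge>M. \<forall>N. (\<Sum>n<N. (norm (ell2_nth (X k) n - l n))\<^sup>2) \<le> e\<^sup>2" if "0 < e" for e :: real
  proof -
    obtain M where M: "\<And>i j. i \<ge> M \<Longrightarrow> j \<ge> M \<Longrightarrow> norm (X i - X j) < e"
      using CauchyD[OF X \<open>0 < e\<close>] by blast
    have "(\<Sum>n<N. (norm (ell2_nth (X k) n - l n))\<^sup>2) \<le> e\<^sup>2" if k: "k \<ge> M" for k N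
    proof (rule LIMSEQ_le_const2)
      show "(\<lambda>j. \<Sum>n<N. (norm (ell2_nth (X k) n - ell2_nth (X j) n))\<^sup>2)
          \<longlonglongrightarrow> (\<Sum>n<N. (norm (ell2_nth (X k) n - l n))\<^sup>2)"
        by (intro tendsto_intros l)
      have "(\<Sum>n<N. (norm (ell2_nth (X k) n - ell2_nth (X j) n))\<^sup>2) \<le> e\<^sup>2" if "j \<ge> M" for j
      proof -
        have "(\<Sum>n<N. (norm (ell2_nth (X k) n - ell2_nth (X j) n))\<^sup>2) \<le> (norm (X k - X j))\<^sup>2"
          using ell2_partial_sum_le[of "X k - X j" N] by (simp add: minus_ell2.rep_eq)
        also have "\<dots> \<le> e\<^sup>2"
          using M[OF k that] by (intro power_mono) auto
        finally show ?thesis .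
      qed
      then show "\<exists>M. \<forall>j\<ge>M. (\<Sum>n<N. (norm (ell2_nth (X k) n - ell2_nth (X j) n))\<^sup>2) \<le> e\<^sup>2"
        by blast
    qed
    then show ?thesis by blast
  qed
  obtain M where M: "\<And>N. (\<Sum>n<N. (norm (ell2_nth (X M) n - l n))\<^sup>2) \<le> 1\<^sup>2"
    using key[of 1] by auto
  have "sq_summable (\<lambda>n. ell2_nth (X M) n - l n)"
    unfolding sq_summable_def by (rule summableI_nonneg_bounded) (use M in auto)
  then have "sq_summable (\<lambda>n. - (ell2_nth (X M) n - l n))"
    by (simp add: sq_summable_def norm_minus_commute)
  then have "sq_summable (\<lambda>n. ell2_nth (X M) n + - (ell2_nth (X M) n - l n))"
    using ell2_nth[of "X M"] by (intro sq_summable_add) auto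
  then have sl: "sq_summable l" by simp
  define L where "L = Abs_ell2 l"
  have L: "ell2_nth L = l"
    using sl by (simp add: L_def Abs_ell2_inverse)
  have "X \<longlonglongrightarrow> L"
  proof (rule LIMSEQ_I)
    fix r :: real
    assume r: "0 < r"
    then obtain K where K: "\<And>k N. k \<ge> K \<Longrightarrow> (\<Sum>n<N. (norm (ell2_nth (X k) n - l n))\<^sup>2) \<le> (r/2)\<^sup>2"
      using key[of "r/2"] by auto
    have "norm (X k - L) < r" if "k \<ge> K" for k
    proof -
      have "(norm (X k - L))\<^sup>2 \<le> (r/2)\<^sup>2"
        unfolding norm_ell2_sq
        by (rule suminf_le_const[OF summable_ell2]) (use K[OF that] in \<open>simp add: minus_ell2.rep_eq L\<close>)
      then have "norm (X k - L) \<le> r/2"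
        by (rule power2_le_imp_le) (use r in simp)
      then show ?thesis using r by simp
    qed
    then show "\<exists>K. \<forall>k\<ge>K. norm (X k - L) < r" by blast
  qed
  then show "convergent X" by (auto simp: convergent_def)
qed

definition cinner :: "ell2 \<Rightarrow> ell2 \<Rightarrow> complex" where
  "cinner x y = (\<Sum>n. ell2_nth x n * cnj (ell2_nth y n))"

lemma inner_ell2_eq_Re_cinner: "inner x y = Re (cinner x y)"
proof -
  have *: "inner a b = Re (a * cnj b)" for a b :: complex
    by (simp add: inner_complex_def)
  show ?thesis
    unfolding cinner_def inner_ell2_def *
    by (rule bounded_linear.suminf[OF bounded_linear_Re summable_ell2_prod, symmetric])
qed

definition ell2_basis :: "nat \<Rightarrow> ell2" where
  "ell2_basis k = Abs_ell2 (\<lambda>n. if n = k then 1 else 0)"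

lemma ell2_nth_basis: "ell2_nth (ell2_basis k) n = (if n = k then 1 else 0)"
proof -
  have "summable (\<lambda>n. if n = k then 1 else (0::real))"
    by (rule summable_finite[of "{k}"]) auto
  then have "sq_summable (\<lambda>n. if n = k then 1 else 0)"
    unfolding sq_summable_def
    by (rule back_subst[of summable]) auto
  then show ?thesis
    by (simp add: ell2_basis_def Abs_ell2_inverse)
qed


section \<open>Bounded operators, functional calculus and trace\<close>

text \<open>
  Bounded operators are elements of the library type of bounded real-linear maps. All operators to
  which the notions below are applied are complex-linear; self-adjointness with respect to the
  complex inner product \<open>cinner\<close> also forces complex linearity.
\<close>

definition self_adjoint :: "(ell2 \<Rightarrow>\<^sub>L ell2) \<Rightarrow> bool" where
  "self_adjoint T \<longleftrightarrow> (\<forall>x y. cinner (T x) y = cinner x (T y))"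

definition positive_form :: "(ell2 \<Rightarrow>\<^sub>L ell2) \<Rightarrow> bool" where
  "positive_form T \<longleftrightarrow> (\<forall>x. cinner (T x) x \<in> \<real>\<^sub>\<ge>\<^sub>0)"

definition poly_op :: "real poly \<Rightarrow> ('a::real_normed_vector \<Rightarrow>\<^sub>L 'a) \<Rightarrow> ('a \<Rightarrow>\<^sub>L 'a)" where
  "poly_op p A = (\<Sum>i\<le>degree p. coeff p i *\<^sub>R ((((o\<^sub>L) A) ^^ i) id_blinfun))"

text \<open>Only the real points of the spectrum are recorded; for self-adjoint operators these are all.\<close>

definition op_spectrum :: "('a::real_normed_vector \<Rightarrow>\<^sub>L 'a) \<Rightarrow> real set" where
  "op_spectrum A = {z. \<not> (\<exists>R. R o\<^sub>L (A - z *\<^sub>R id_blinfun) = id_blinfun \<and>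
                              (A - z *\<^sub>R id_blinfun) o\<^sub>L R = id_blinfun)}"

text \<open>
  The continuous functional calculus of a self-adjoint operator: the operator \<open>\<phi>(A)\<close> is the
  operator norm limit of \<open>p\<^sub>n(A)\<close> for any polynomials \<open>p\<^sub>n\<close> converging to \<open>\<phi>\<close> uniformly on the spectrum.
\<close>

definition fun_calc :: "(real \<Rightarrow> real) \<Rightarrow> ('a::real_normed_vector \<Rightarrow>\<^sub>L 'a) \<Rightarrow> ('a \<Rightarrow>\<^sub>L 'a)" where
  "fun_calc \<phi> A = (THE T. \<exists>p. uniform_limit (op_spectrum A) (\<lambda>n. poly (p n)) \<phi> sequentially \<and>
                              (\<lambda>n. poly_op (p n) A) \<longlonglongrightarrow> T)"

text \<open>In the next definition, \<open>P\<close> is the absolute value \<open>(T\<^sup>* T)\<^sup>1\<^sup>/\<^sup>2\<close>.\<close>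

definition trace_class :: "(ell2 \<Rightarrow>\<^sub>L ell2) \<Rightarrow> bool" where
  "trace_class T \<longleftrightarrow>
     (\<exists>P. self_adjoint P \<and> positive_form P \<and>
          (\<forall>x y. cinner (P (P x)) y = cinner (T x) (T y)) \<and>
          summable (\<lambda>n. cinner (P (ell2_basis n)) (ell2_basis n)))"

definition op_trace :: "(ell2 \<Rightarrow>\<^sub>L ell2) \<Rightarrow> complex" where
  "op_trace T = (\<Sum>n. cinner (T (ell2_basis n)) (ell2_basis n))"


section \<open>The spectral shift function\<close>

definition test_function :: "(real \<Rightarrow> real) \<Rightarrow> bool" where
  "test_function \<phi> \<longleftrightarrow>
     (\<forall>k x. (deriv ^^ k) \<phi> differentiable (at x)) \<and> compact (closure {x. \<phi> x \<noteq> 0})"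

text \<open>
  \<open>is_spectral_shift \<xi> B A\<close> says that \<open>\<xi>\<close> is (a representative of) the spectral shift function
  \<open>\<xi>(\<cdot>; B, A)\<close>, for self-adjoint \<open>A\<close>, \<open>B\<close> with \<open>B - A\<close> of trace class. It is a predicate because \<open>\<xi>\<close>
  is determined only up to null sets. Real test functions suffice, by linearity.
\<close>

definition is_spectral_shift ::
    "(real \<Rightarrow> real) \<Rightarrow> (ell2 \<Rightarrow>\<^sub>L ell2) \<Rightarrow> (ell2 \<Rightarrow>\<^sub>L ell2) \<Rightarrow> bool" where
  "is_spectral_shift \<xi> B A \<longleftrightarrow>
     integrable lebesgue \<xi> \<and>
     (\<forall>\<phi>. test_function \<phi> \<longrightarrow>
        trace_class (fun_calc \<phi> B - fun_calc \<phi> A) \<and>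
        op_trace (fun_calc \<phi> B - fun_calc \<phi> A) =
          complex_of_real (LINT l|lebesgue. \<xi> l * deriv \<phi> l))"


section \<open>Hankel operators\<close>

definition ell1_weak :: "(nat \<Rightarrow> 'a::real_normed_vector) set" where
  "ell1_weak = {x. bdd_above (range (\<lambda>n. (real n + 1) * norm (x n)))}"

definition shift :: "(nat \<Rightarrow> 'a) \<Rightarrow> (nat \<Rightarrow> 'a)" where
  "shift \<alpha> = (\<lambda>n. \<alpha> (n + 1))"

definition hankel :: "(nat \<Rightarrow> real) \<Rightarrow> (ell2 \<Rightarrow>\<^sub>L ell2)" where
  "hankel \<alpha> = Blinfun (\<lambda>x. Abs_ell2 (\<lambda>n. \<Sum>m. complex_of_real (\<alpha> (n + m)) * ell2_nth x m))"

text \<open>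
  The definition uses the total functions \<open>Blinfun\<close> and \<open>Abs_ell2\<close>. The following lemmas (Hilbert's
  inequality, by the Schur test) show that the matrix does define a bounded operator for sequences
  in \<open>ell1_weak\<close>, so that \<open>hankel\<close> has the intended meaning there.
\<close>

lemma schur_row_bound:
  fixes n M :: nat
  shows "(\<Sum>m<M. 1 / ((real n + real m + 1) * sqrt (real m + 1))) \<le> 4 / sqrt (real n + 1)"
proof -
  define s where "s = (\<lambda>k::nat. sqrt (real k))"
  have s_pos: "s (Suc k) > 0" for k by (simp add: s_def)
  have s_mono: "s k \<le> s (Suc k)" "s k \<ge> 0" for k by (auto simp: s_def)
  have s_sq: "s k * s k = real k" for k by (simp add: s_def)
  have diff: "1 \<le> 2 * s (Suc k) * (s (Suc k) - s k)" for k
  proof -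
    have "1 = s (Suc k) * s (Suc k) - s k * s k" by (simp add: s_sq)
    also have "\<dots> = (s (Suc k) + s k) * (s (Suc k) - s k)" by (simp add: algebra_simps)
    also have "\<dots> \<le> (2 * s (Suc k)) * (s (Suc k) - s k)"
      using s_mono by (intro mult_right_mono) auto
    finally show ?thesis .
  qed
  have step1: "1 / s (Suc k) \<le> 2 * s (Suc k) - 2 * s k" for k
    using diff[of k] s_pos[of k] by (simp add: field_simps)
  have step2: "1 / (real (Suc k) * s (Suc k)) \<le> 2 / s k - 2 / s (Suc k)" if "k > 0" for k
  proof -
    have p: "s k > 0" using that by (simp add: s_def)
    have "1 / (real (Suc k) * s (Suc k)) = 1 / (s (Suc k) * s (Suc k) * s (Suc k))"
      by (simp add: s_sq)
    also have "\<dots> \<le> (2 * s (Suc k) * (s (Suc k) - s k)) / (s (Suc k) * s (Suc k) * s (Suc k))"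
      using diff[of k] s_pos[of k] by (intro divide_right_mono) auto
    also have "\<dots> = 2 * (s (Suc k) - s k) / (s (Suc k) * s (Suc k))"
      using s_pos[of k] by (simp add: field_simps)
    also have "\<dots> \<le> 2 * (s (Suc k) - s k) / (s k * s (Suc k))"
      using s_pos[of k] p s_mono by (intro divide_left_mono mult_right_mono mult_pos_pos) auto
    also have "\<dots> = 2 / s k - 2 / s (Suc k)"
      using s_pos[of k] p by (simp add: field_simps)
    finally show ?thesis .
  qed
  have claim: "(\<Sum>m<M. 1 / ((real n + real m + 1) * s (Suc m)))
      \<le> (if M \<le> Suc n then 2 * s M / real (Suc n) else 4 / s (Suc n) - 2 / s M)"
  proof (induction M)
    case 0
    show ?case by (simp add: s_def)
  next
    case (Suc M)
    show ?case
    proof (cases "Suc M \<le> Suc n")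
      case True
      have "1 / ((real n + real M + 1) * s (Suc M)) \<le> 1 / (real (Suc n) * s (Suc M))"
        using s_pos[of M] by (intro divide_left_mono mult_right_mono mult_pos_pos) auto
      also have "\<dots> = (1 / s (Suc M)) / real (Suc n)" by simp
      also have "\<dots> \<le> (2 * s (Suc M) - 2 * s M) / real (Suc n)"
        using step1 by (intro divide_right_mono) auto
      finally show ?thesis using Suc.IH True by (simp add: diff_divide_distrib)
    next
      case False
      then have M: "M > 0" "Suc n \<le> M" by auto
      have "1 / ((real n + real M + 1) * s (Suc M)) \<le> 1 / (real (Suc M) * s (Suc M))"
        using s_pos[of M] by (intro divide_left_mono mult_right_mono mult_pos_pos) auto
      also have "\<dots> \<le> 2 / s M - 2 / s (Suc M)" by (rule step2[OF M(1)])
      finally have st: "1 / ((real n + real M + 1) * s (Suc M)) \<le> 2 / s M - 2 / s (Suc M)" .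
      have "(\<Sum>m<M. 1 / ((real n + real m + 1) * s (Suc m))) \<le> 4 / s (Suc n) - 2 / s M"
      proof (cases "M = Suc n")
        case True
        have "2 * s M / real (Suc n) = 2 / s M"
          using s_pos[of n] s_sq[of "Suc n"] True by (simp add: field_simps)
        then show ?thesis using Suc.IH True by simp
      next
        case False
        then show ?thesis using Suc.IH M by simp
      qed
      then show ?thesis using st False by simp
    qed
  qed
  have "(if M \<le> Suc n then 2 * s M / real (Suc n) else 4 / s (Suc n) - 2 / s M) \<le> 4 / s (Suc n)"
  proof (cases "M \<le> Suc n")
    case True
    then have "2 * s M / real (Suc n) \<le> 2 * s (Suc n) / real (Suc n)"
      by (intro divide_right_mono) (auto simp: s_def)
    also have "\<dots> = 2 / s (Suc n)"
      using s_pos[of n] s_sq[of "Suc n"] by (simp add: field_simps)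
    also have "\<dots> \<le> 4 / s (Suc n)" using s_pos[of n] by (intro divide_right_mono) auto
    finally show ?thesis using True by simp
  qed (use s_mono in simp)
  then show ?thesis using claim by (simp add: s_def add.commute)
qed

lemma hilbert_inequality_finite:
  fixes x :: "nat \<Rightarrow> real"
  shows "(\<Sum>n<N. (\<Sum>m<M. \<bar>x m\<bar> / (real n + real m + 1))\<^sup>2) \<le> 16 * (\<Sum>m<M. (x m)\<^sup>2)"
proof -
  define k where "k = (\<lambda>n m::nat. 1 / (real n + real m + 1))"
  define w where "w = (\<lambda>m::nat. sqrt (real m + 1))"
  have w: "w m > 0" for m by (simp add: w_def)
  have k: "k n m > 0" for n m by (simp add: k_def add_nonneg_pos)
  have row: "(\<Sum>m<M. k n m / w m) \<le> 4 / w n" for n M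
    using schur_row_bound[of n M] by (simp add: k_def w_def)
  have col: "(\<Sum>n<N. k n m / w n) \<le> 4 / w m" for m N
    using schur_row_bound[of m N] by (simp add: k_def w_def add.commute)
  have cs: "(\<Sum>m<M. \<bar>x m\<bar> * k n m)\<^sup>2 \<le> (4 / w n) * (\<Sum>m<M. k n m * w m * (x m)\<^sup>2)" for n
  proof -
    have "(\<Sum>m<M. \<bar>x m\<bar> * k n m)
        = (\<Sum>m<M. sqrt (k n m / w m) * (sqrt (k n m * w m) * \<bar>x m\<bar>))"
    proof (rule sum.cong[OF refl])
      fix m
      have "sqrt (k n m / w m) * sqrt (k n m * w m) = sqrt ((k n m)\<^sup>2)"
        using w[of m] by (subst real_sqrt_mult[symmetric]) (simp add: power2_eq_square)
      then show "\<bar>x m\<bar> * k n m = sqrt (k n m / w m) * (sqrt (k n m * w m) * \<bar>x m\<bar>)"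
        using k[of n m] by (simp add: mult.assoc[symmetric])
    qed
    then have "(\<Sum>m<M. \<bar>x m\<bar> * k n m)\<^sup>2
        \<le> (\<Sum>m<M. (sqrt (k n m / w m))\<^sup>2) * (\<Sum>m<M. (sqrt (k n m * w m) * \<bar>x m\<bar>)\<^sup>2)"
      using Cauchy_Schwarz_ineq_sum by metis
    also have "\<dots> = (\<Sum>m<M. k n m / w m) * (\<Sum>m<M. k n m * w m * (x m)\<^sup>2)"
      using k w by (simp add: power_mult_distrib less_imp_le)
    also have "\<dots> \<le> (4 / w n) * (\<Sum>m<M. k n m * w m * (x m)\<^sup>2)"
      using k w row by (intro mult_right_mono sum_nonneg mult_nonneg_nonneg) (auto simp: less_imp_le)
    finally show ?thesis .
  qed
  have "(\<Sum>n<N. (\<Sum>m<M. \<bar>x m\<bar> * k n m)\<^sup>2)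
      \<le> (\<Sum>n<N. (4 / w n) * (\<Sum>m<M. k n m * w m * (x m)\<^sup>2))"
    by (intro sum_mono cs)
  also have "\<dots> = (\<Sum>n<N. \<Sum>m<M. 4 * (w m * (x m)\<^sup>2) * (k n m / w n))"
    by (simp add: sum_distrib_left mult_ac)
  also have "\<dots> = (\<Sum>m<M. 4 * (w m * (x m)\<^sup>2) * (\<Sum>n<N. k n m / w n))"
    by (subst sum.swap) (simp add: sum_distrib_left)
  also have "\<dots> \<le> (\<Sum>m<M. 4 * (w m * (x m)\<^sup>2) * (4 / w m))"
    using w col by (intro sum_mono mult_left_mono) (auto simp: less_imp_le)
  also have "\<dots> = (\<Sum>m<M. 16 * (x m)\<^sup>2)"
    using w by (intro sum.cong) (auto simp: less_imp_neq[symmetric])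
  finally show ?thesis by (simp add: k_def sum_distrib_left)
qed

lemma ell1_weakE:
  fixes \<alpha> :: "nat \<Rightarrow> real"
  assumes "\<alpha> \<in> ell1_weak"
  obtains C where "C \<ge> 0" "\<And>n. \<bar>\<alpha> n\<bar> \<le> C / (real n + 1)"
proof -
  obtain C where C: "\<And>n. (real n + 1) * \<bar>\<alpha> n\<bar> \<le> C"
    using assms by (auto simp: ell1_weak_def bdd_above_def)
  have "C \<ge> 0" using C[of 0] by simp
  moreover have "\<bar>\<alpha> n\<bar> \<le> C / (real n + 1)" for n
    using C[of n] by (simp add: field_simps)
  ultimately show ?thesis by (rule that)
qed

lemma hankel_row_summable:
  assumes "\<alpha> \<in> ell1_weak"
  shows "summable (\<lambda>m. norm (complex_of_real (\<alpha> (n + m)) * ell2_nth x m))"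
proof -
  obtain C where C: "C \<ge> 0" "\<And>n. \<bar>\<alpha> n\<bar> \<le> C / (real n + 1)"
    using ell1_weakE[OF assms] by blast
  have "summable (\<lambda>m. 1 / (real (Suc m))\<^sup>2)"
    using inverse_power_summable[of 2, where 'a=real] by (subst summable_Suc_iff) (simp add: field_simps)
  then have "summable (\<lambda>m. C\<^sup>2 * (1 / (real (Suc m))\<^sup>2) + (norm (ell2_nth x m))\<^sup>2)"
    by (intro summable_add summable_mult summable_ell2)
  then show ?thesis
  proof (rule summable_comparison_test'[where N = 0])
    fix m
    have "\<bar>\<alpha> (n + m)\<bar> \<le> C / (real (n + m) + 1)" by (rule C)
    also have "\<dots> \<le> C / real (Suc m)"
      using C(1) by (intro divide_left_mono mult_pos_pos) auto
    finally have "\<bar>\<alpha> (n + m)\<bar> * norm (ell2_nth x m) \<le> C / real (Suc m) * norm (ell2_nth x m)"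
      by (rule mult_right_mono) simp
    also have "\<dots> \<le> (C / real (Suc m))\<^sup>2 + (norm (ell2_nth x m))\<^sup>2"
    proof -
      have "0 \<le> C / real (Suc m) * norm (ell2_nth x m)" using C(1) by simp
      then show ?thesis
        using sum_squares_bound[of "C / real (Suc m)" "norm (ell2_nth x m)"] by linarith
    qed
    finally show "norm (norm (complex_of_real (\<alpha> (n + m)) * ell2_nth x m))
        \<le> C\<^sup>2 * (1 / (real (Suc m))\<^sup>2) + (norm (ell2_nth x m))\<^sup>2"
      by (simp add: norm_mult abs_mult power_divide)
  qed
qed

lemma hankel_partial_bound:
  assumes "\<And>n. \<bar>\<alpha> n\<bar> \<le> C / (real n + 1)" "C \<ge> 0" "\<alpha> \<in> ell1_weak"
  shows "(\<Sum>n<N. (norm (\<Sum>m. complex_of_real (\<alpha> (n + m)) * ell2_nth x m))\<^sup>2) \<le> (4 * C * norm x)\<^sup>2"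
proof (rule LIMSEQ_le_const2)
  let ?f = "\<lambda>n m. complex_of_real (\<alpha> (n + m)) * ell2_nth x m"
  have "summable (?f n)" for n
    by (rule summable_norm_cancel) (rule hankel_row_summable[OF assms(3)])
  then have "(\<lambda>M. \<Sum>m<M. ?f n m) \<longlonglongrightarrow> (\<Sum>m. ?f n m)" for n
    by (rule summable_LIMSEQ)
  then show "(\<lambda>M. \<Sum>n<N. (norm (\<Sum>m<M. ?f n m))\<^sup>2) \<longlonglongrightarrow> (\<Sum>n<N. (norm (\<Sum>m. ?f n m))\<^sup>2)"
    by (intro tendsto_intros)
  have "(\<Sum>n<N. (norm (\<Sum>m<M. ?f n m))\<^sup>2) \<le> (4 * C * norm x)\<^sup>2" for M
  proof -
    have "norm (\<Sum>m<M. ?f n m) \<le> C * (\<Sum>m<M. \<bar>norm (ell2_nth x m)\<bar> / (real n + real m + 1))" for n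
    proof -
      have "norm (\<Sum>m<M. ?f n m) \<le> (\<Sum>m<M. norm (?f n m))" by (rule norm_sum)
      also have "\<dots> \<le> (\<Sum>m<M. C / (real n + real m + 1) * norm (ell2_nth x m))"
      proof (rule sum_mono)
        fix m
        show "norm (?f n m) \<le> C / (real n + real m + 1) * norm (ell2_nth x m)"
          using mult_right_mono[OF assms(1)[of "n + m"] norm_ge_zero[of "ell2_nth x m"]]
          by (simp add: norm_mult)
      qed
      finally show ?thesis by (simp add: sum_distrib_left)
    qed
    then have "(\<Sum>n<N. (norm (\<Sum>m<M. ?f n m))\<^sup>2)
        \<le> (\<Sum>n<N. (C * (\<Sum>m<M. \<bar>norm (ell2_nth x m)\<bar> / (real n + real m + 1)))\<^sup>2)"
      by (intro sum_mono power_mono) auto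
    also have "\<dots> = C\<^sup>2 * (\<Sum>n<N. (\<Sum>m<M. \<bar>norm (ell2_nth x m)\<bar> / (real n + real m + 1))\<^sup>2)"
      unfolding power_mult_distrib by (rule sum_distrib_left[symmetric])
    also have "\<dots> \<le> C\<^sup>2 * (16 * (\<Sum>m<M. (norm (ell2_nth x m))\<^sup>2))"
      by (intro mult_left_mono hilbert_inequality_finite) auto
    also have "\<dots> \<le> C\<^sup>2 * (16 * (norm x)\<^sup>2)"
      by (intro mult_left_mono ell2_partial_sum_le) auto
    finally show ?thesis by (simp add: power_mult_distrib)
  qed
  then show "\<exists>M0. \<forall>M\<ge>M0. (\<Sum>n<N. (norm (\<Sum>m<M. ?f n m))\<^sup>2) \<le> (4 * C * norm x)\<^sup>2" by blast
qed

lemma ell2_nth_hankel: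
  assumes "\<alpha> \<in> ell1_weak"
  shows "ell2_nth (hankel \<alpha> x) n = (\<Sum>m. complex_of_real (\<alpha> (n + m)) * ell2_nth x m)"
proof -
  obtain C where C: "C \<ge> 0" "\<And>n. \<bar>\<alpha> n\<bar> \<le> C / (real n + 1)"
    using ell1_weakE[OF assms] by blast
  let ?g = "\<lambda>x n. \<Sum>m. complex_of_real (\<alpha> (n + m)) * ell2_nth x m"
  let ?G = "\<lambda>x. Abs_ell2 (?g x)"
  note bd = hankel_partial_bound[OF C(2) C(1) assms]
  have "sq_summable (?g x)" for x
    unfolding sq_summable_def
    by (rule summableI_nonneg_bounded[where x = "(4 * C * norm x)\<^sup>2"]) (use bd in auto)
  then have G: "ell2_nth (?G x) = ?g x" for x
    by (simp add: Abs_ell2_inverse)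
  have sm: "summable (\<lambda>m. complex_of_real (\<alpha> (n + m)) * ell2_nth x m)" for n x
    by (rule summable_norm_cancel) (rule hankel_row_summable[OF assms])
  have "bounded_linear ?G"
  proof (rule bounded_linear_intro[where K = "4 * C"])
    show "?G (x + y) = ?G x + ?G y" for x y
    proof (rule ell2_eqI)
      fix n
      have "?g (x + y) n = ?g x n + ?g y n"
        by (simp add: plus_ell2.rep_eq distrib_left suminf_add[OF sm sm])
      then show "ell2_nth (?G (x + y)) n = ell2_nth (?G x + ?G y) n"
        by (simp only: G plus_ell2.rep_eq[of "?G x" "?G y"])
    qed
    show "?G (r *\<^sub>R x) = r *\<^sub>R ?G x" for r x
    proof (rule ell2_eqI)
      fix n
      have "?g (r *\<^sub>R x) n = (\<Sum>m. r *\<^sub>R (complex_of_real (\<alpha> (n + m)) * ell2_nth x m))"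
        by (simp add: scaleR_ell2.rep_eq)
      also have "\<dots> = r *\<^sub>R ?g x n"
        by (rule suminf_scaleR_right[OF sm, symmetric])
      finally show "ell2_nth (?G (r *\<^sub>R x)) n = ell2_nth (r *\<^sub>R ?G x) n"
        by (simp only: G scaleR_ell2.rep_eq[of r "?G x"])
    qed
    show "norm (?G x) \<le> norm x * (4 * C)" for x
    proof -
      have "(norm (?G x))\<^sup>2 \<le> (4 * C * norm x)\<^sup>2"
        unfolding norm_ell2_sq
        by (rule suminf_le_const[OF summable_ell2]) (use bd in \<open>simp add: G\<close>)
      then have "norm (?G x) \<le> 4 * C * norm x"
        by (rule power2_le_imp_le) (use C(1) in simp)
      then show ?thesis by (simp add: mult.commute)
    qed
  qed
  then show ?thesis
    by (simp add: hankel_def bounded_linear_Blinfun_apply G)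
qed

lemma shift_ell1_weak:
  assumes "\<alpha> \<in> ell1_weak"
  shows "shift \<alpha> \<in> ell1_weak"
proof -
  obtain C where C: "\<And>n. (real n + 1) * norm (\<alpha> n) \<le> C"
    using assms by (auto simp: ell1_weak_def bdd_above_def)
  have "(real n + 1) * norm (\<alpha> (Suc n)) \<le> C" for n
  proof -
    have "(real n + 1) * norm (\<alpha> (Suc n)) \<le> (real (Suc n) + 1) * norm (\<alpha> (Suc n))"
      by (intro mult_right_mono) auto
    then show ?thesis using C[of "Suc n"] by linarith
  qed
  then show ?thesis
    by (auto simp: ell1_weak_def shift_def bdd_above_def)
qed

definition ell1_weak_pp :: "(nat \<Rightarrow> real) set" where
  "ell1_weak_pp = {\<alpha> \<in> ell1_weak. positive_form (hankel \<alpha>) \<and> positive_form (hankel (shift \<alpha>))}"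

text \<open>
  \<open>is_hankel_ssf \<xi> \<alpha>\<close> says that \<open>\<xi>\<close> is (a representative of) the function \<open>\<xi>\<^sub>\<alpha>\<close>.
\<close>

definition is_hankel_ssf :: "(real \<Rightarrow> real) \<Rightarrow> (nat \<Rightarrow> real) \<Rightarrow> bool" where
  "is_hankel_ssf \<xi> \<alpha> \<longleftrightarrow>
     is_spectral_shift \<xi> (hankel \<alpha> o\<^sub>L hankel \<alpha>) (hankel (shift \<alpha>) o\<^sub>L hankel (shift \<alpha>))"

end

theory Submission
  imports Defs "HOL-Computational_Algebra.Fundamental_Theorem_Algebra"
begin

text \<open>
  Write \<open>B = \<Gamma>\<^sub>\<alpha>\<^sup>2\<close> and \<open>A = \<Gamma>\<^sub>S\<^sub>\<alpha>\<^sup>2 = B - (\<cdot>, \<alpha>) \<alpha>\<close>. Testing the trace formula with \<open>1 / (x + z)\<close> gives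
  \<open>\<integral> \<xi> / (\<lambda> + z)\<^sup>2 d\<lambda> = Tr ((A + z)\<inverse> - (B + z)\<inverse>) = \<parallel>(B + z)\<inverse> \<alpha>\<parallel>\<^sup>2 / D(z)\<close> with the perturbation
  determinant \<open>D(z) = 1 - ((B + z)\<inverse> \<alpha>, \<alpha>)\<close>. The right-hand side is \<open>D' / D\<close>, so
  \<open>D(z) = exp (- \<integral> \<xi> / (\<lambda> + z) d\<lambda>)\<close>, both sides tending to \<open>1\<close> as \<open>z \<rightarrow> \<infinity>\<close>; multiplying the trace identity
  by \<open>z\<^sup>2\<close> and letting \<open>z \<rightarrow> \<infinity>\<close> gives the first claim. For the second, \<open>\<alpha> = \<Gamma>\<^sub>\<alpha> e\<^sub>0\<close> turns
  \<open>1 - D(t\<^sup>2)\<close> into \<open>(\<Gamma>\<^sub>\<alpha>\<^sup>2 (\<Gamma>\<^sub>\<alpha>\<^sup>2 + t\<^sup>2)\<inverse> e\<^sub>0, e\<^sub>0)\<close>, whose integral over \<open>t > 0\<close> is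
  \<open>\<pi>/2 (\<Gamma>\<^sub>\<alpha> e\<^sub>0, e\<^sub>0) = \<pi>/2 \<alpha>\<^sub>0\<close> because \<open>\<Gamma>\<^sub>\<alpha> \<ge> 0\<close>.
\<close>

section \<open>Smooth test functions\<close>

text \<open>The trace formula speaks only of \<open>fun_calc\<close> at smooth compactly supported
  functions, and \<open>fun_calc\<close> is a definite description over limits of polynomials. Every
  evaluation of it needs uniqueness of those limits. This is drawn from one estimate: for a
  symmetric operator the norm of \<open>poly_op p A\<close> is at most the supremum of the absolute
  value of \<open>p\<close> over \<open>op_spectrum A\<close>. The same estimate does the work of a
  spectral measure: a parameter is differentiated under the calculus by scalar remainder bounds that
  are uniform on the spectrum. Besides the trace formula, only integrability of \<open>\<xi>\<close>
  is at hand, neither sign nor support. Limits on the integral side therefore use a multiple of its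
  absolute value as majorant. The inner product is the real part of the complex one, so the rank one
  formula for \<open>A\<close> holds in this form only on vectors with real coordinates. As
  \<open>\<alpha>\<close> is real, such vectors are preserved by the Hankel operators and by the
  resolvent of \<open>B\<close>, and the basis that computes the trace consists of them.\<close>

definition flat :: "nat \<Rightarrow> real \<Rightarrow> real" where
  "flat k x = (if x > 0 then exp (- (1 / x)) / x ^ k else 0)"

lemma flat_nonneg: "flat k x \<ge> 0"
  by (simp add: flat_def)

lemma flat_pos: "x > 0 \<Longrightarrow> flat k x > 0"
  by (simp add: flat_def)

lemma flat_eq_0: "x \<le> 0 \<Longrightarrow> flat k x = 0"
  by (simp add: flat_def)

lemma flat_tendsto_0: "(flat k \<longlongrightarrow> 0) (at 0)"
proof -
  have "((\<lambda>x. inverse x ^ k / exp (inverse x)) \<longlongrightarrow> 0) (at_right (0::real))"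
    by (rule filterlim_compose[OF tendsto_power_div_exp_0 filterlim_inverse_at_top_right])
  moreover have "eventually (\<lambda>x. inverse x ^ k / exp (inverse x) = flat k x) (at_right 0)"
    by (rule eventually_at_rightI[of 0 1])
       (auto simp: flat_def exp_minus field_simps)
  ultimately have "(flat k \<longlongrightarrow> 0) (at_right 0)"
    by (rule Lim_transform_eventually)
  moreover have "(flat k \<longlongrightarrow> 0) (at_left 0)"
    by (rule Lim_transform_eventually[OF tendsto_const])
       (rule eventually_at_leftI[of "-1"], auto simp: flat_def)
  ultimately show ?thesis
    by (simp add: filterlim_split_at)
qed

text \<open>The powers of \<open>x\<close> in the denominator are carried along because they make
  the family closed under differentiation up to linear combinations.\<close>

lemma DERIV_flat: "(flat k has_real_derivative flat (k + 2) x - k * flat (k + 1) x) (at x)"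
proof -
  consider "x > 0" | "x < 0" | "x = 0" by linarith
  then show ?thesis
  proof cases
    case 1
    have "((\<lambda>x. exp (- (1 / x)) / x ^ k) has_real_derivative flat (k + 2) x - k * flat (k + 1) x) (at x)"
    proof (cases k)
      case 0
      then show ?thesis using 1
        by (auto intro!: derivative_eq_intros simp: flat_def field_simps power2_eq_square)
    next
      case (Suc j)
      then show ?thesis using 1
        by (auto intro!: derivative_eq_intros simp: flat_def field_simps power2_eq_square power_eq_if[of x j])
    qed
    then show ?thesis
      by (rule has_field_derivative_transform_within_open[where S = "{0<..}"])
         (use 1 in \<open>auto simp: flat_def\<close>)
  next
    case 2
    have "((\<lambda>x. 0) has_real_derivative 0) (at x)" by simp
    then have "(flat k has_real_derivative 0) (at x)"
      by (rule has_field_derivative_transform_within_open[where S = "{..<0}"])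
         (use 2 in \<open>auto simp: flat_def\<close>)
    then show ?thesis using 2 by (simp add: flat_def)
  next
    case 3
    \<comment> \<open>At the origin the difference quotient of one member is the next member of the
      family, which tends to 0.\<close>
    have "((\<lambda>h. (flat k (0 + h) - flat k 0) / h) \<longlongrightarrow> 0) (at 0)"
    proof (rule Lim_transform_eventually[OF flat_tendsto_0[of "Suc k"]])
      show "eventually (\<lambda>h. flat (Suc k) h = (flat k (0 + h) - flat k 0) / h) (at 0)"
        by (auto simp: flat_def eventually_at_filter)
    qed
    then show ?thesis using 3 by (simp add: DERIV_def flat_def)
  qed
qed

text \<open>A class given by formation rules and closed under \<open>deriv\<close>: one induction
  then yields derivatives of all orders, as \<open>test_function\<close> demands, for every cut-off
  built below.\<close>

inductive elementary :: "(real \<Rightarrow> real) \<Rightarrow> bool" where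
  const: "elementary (\<lambda>x. c)"
| ident: "elementary (\<lambda>x. x)"
| add: "elementary f \<Longrightarrow> elementary g \<Longrightarrow> elementary (\<lambda>x. f x + g x)"
| mult: "elementary f \<Longrightarrow> elementary g \<Longrightarrow> elementary (\<lambda>x. f x * g x)"
| inverse: "elementary f \<Longrightarrow> (\<And>x. f x \<noteq> 0) \<Longrightarrow> elementary (\<lambda>x. inverse (f x))"
| flat: "elementary f \<Longrightarrow> elementary (\<lambda>x. flat k (f x))"

lemma elementary_diff: "elementary f \<Longrightarrow> elementary g \<Longrightarrow> elementary (\<lambda>x. f x - g x)"
  using elementary.add[OF _ elementary.mult[OF elementary.const[of "-1"]], of f g] by simp

lemma elementary_divide:
  "elementary f \<Longrightarrow> elementary g \<Longrightarrow> (\<And>x. g x \<noteq> 0) \<Longrightarrow> elementary (\<lambda>x. f x / g x)"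
  using elementary.mult[OF _ elementary.inverse, of f g] by (simp add: field_simps)

lemmas elementary_intros = elementary.intros elementary_diff elementary_divide

lemma elementary_has_derivative:
  "elementary f \<Longrightarrow> \<exists>f'. elementary f' \<and> (\<forall>x. (f has_real_derivative f' x) (at x))"
proof (induction rule: elementary.induct)
  case (const c)
  show ?case by (rule exI[of _ "\<lambda>x. 0"]) (auto intro: elementary_intros)
next
  case ident
  show ?case by (rule exI[of _ "\<lambda>x. 1"]) (auto intro: elementary_intros)
next
  case (add f g)
  then obtain f' g' where "elementary f'" "\<forall>x. (f has_real_derivative f' x) (at x)"
    "elementary g'" "\<forall>x. (g has_real_derivative g' x) (at x)" by auto
  then show ?case
    by (intro exI[of _ "\<lambda>x. f' x + g' x"]) (auto intro!: elementary_intros derivative_intros)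
next
  case (mult f g)
  then obtain f' g' where "elementary f'" "\<forall>x. (f has_real_derivative f' x) (at x)"
    "elementary g'" "\<forall>x. (g has_real_derivative g' x) (at x)" by auto
  with mult.hyps show ?case
    by (intro exI[of _ "\<lambda>x. f' x * g x + g' x * f x"])
       (auto intro!: elementary_intros derivative_intros)
next
  case (inverse f)
  then obtain f' where "elementary f'" "\<forall>x. (f has_real_derivative f' x) (at x)" by auto
  moreover from this inverse.hyps have "elementary (\<lambda>x. (-1) * (inverse (f x) * f' x * inverse (f x)))"
    by (intro elementary_intros)
  ultimately show ?case
    using inverse.hyps
    by (intro exI[of _ "\<lambda>x. (-1) * (inverse (f x) * f' x * inverse (f x))"])
       (auto intro!: derivative_eq_intros)
next
  case (flat f k)
  then obtain f' where f': "elementary f'" "\<forall>x. (f has_real_derivative f' x) (at x)" by auto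
  then have "elementary (\<lambda>x. (flat (k + 2) (f x) - real k * flat (k + 1) (f x)) * f' x)"
    using flat.hyps by (intro elementary_intros)
  moreover have "((\<lambda>x. flat k (f x)) has_real_derivative
      (flat (k + 2) (f x) - real k * flat (k + 1) (f x)) * f' x) (at x)" for x
    using DERIV_chain2[OF DERIV_flat] f'(2) by blast
  ultimately show ?case by blast
qed

lemma
  assumes "elementary f"
  shows elementary_deriv: "elementary (deriv f)"
    and elementary_DERIV: "(f has_real_derivative deriv f x) (at x)"
proof -
  obtain f' where f': "elementary f'" "\<And>x. (f has_real_derivative f' x) (at x)"
    using elementary_has_derivative[OF assms] by blast
  then have "deriv f = f'" by (intro ext DERIV_imp_deriv)
  with f' show "elementary (deriv f)" "(f has_real_derivative deriv f x) (at x)" by auto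
qed

lemma elementary_isCont: "elementary f \<Longrightarrow> isCont f x"
  using DERIV_isCont elementary_DERIV by blast

text \<open>The cut-offs are explicit outside a compact transition zone; inside it, continuity of
  the derivative supplies the bound.\<close>

lemma elementary_deriv_bounded_outside:
  assumes "elementary f" and bd: "\<And>x. x < a \<or> b < x \<Longrightarrow> \<bar>deriv f x\<bar> \<le> c"
  obtains C where "\<And>x. \<bar>deriv f x\<bar> \<le> C"
proof -
  have "continuous_on {a..b} (deriv f)"
    using elementary_isCont[OF elementary_deriv[OF assms(1)]]
    by (intro continuous_at_imp_continuous_on) auto
  then have "bounded (deriv f ` {a..b})"
    using compact_continuous_image compact_imp_bounded compact_Icc by blast
  then obtain C where C: "\<And>x. x \<in> {a..b} \<Longrightarrow> \<bar>deriv f x\<bar> \<le> C"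
    unfolding bounded_iff real_norm_def by blast
  show ?thesis
  proof (rule that)
    show "\<bar>deriv f x\<bar> \<le> max c C" for x
      using bd[of x] C[of x] by (cases "x \<in> {a..b}") force+
  qed
qed

lemma elementary_test_function:
  assumes "elementary f" and "\<And>x. \<bar>x\<bar> > r \<Longrightarrow> f x = 0"
  shows "test_function f"
proof -
  have "elementary ((deriv ^^ k) f)" for k
    by (induction k) (auto simp: assms(1) elementary_deriv)
  then have "(deriv ^^ k) f differentiable (at x)" for k x
    using elementary_DERIV real_differentiable_def by blast
  moreover have "{x. f x \<noteq> 0} \<subseteq> {-r..r}"
  proof
    fix x assume "x \<in> {x. f x \<noteq> 0}"
    with assms(2)[of x] show "x \<in> {-r..r}" by force
  qed
  then have "bounded {x. f x \<noteq> 0}"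
    using bounded_subset bounded_closed_interval by blast
  ultimately show ?thesis
    by (simp add: test_function_def)
qed

section \<open>Smooth cut-offs and approximation of \<open>1 / (x + z)\<close>\<close>

definition smooth_step :: "real \<Rightarrow> real" where
  "smooth_step x = flat 0 x / (flat 0 x + flat 0 (1 - x))"

text \<open>\<open>x\<close> and \<open>1 - x\<close> cannot both be nonpositive, so one of the two
  summands is always positive.\<close>

lemma smooth_step_denominator_pos: "flat 0 x + flat 0 (1 - x) > 0"
  using flat_nonneg[of 0 x] flat_nonneg[of 0 "1 - x"] flat_pos[of x 0] flat_pos[of "1 - x" 0]
  by linarith

lemma elementary_smooth_step:
  assumes "elementary f" shows "elementary (\<lambda>x. smooth_step (f x))"
proof -
  have "flat 0 (f x) + flat 0 (1 - f x) \<noteq> 0" for x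
    using smooth_step_denominator_pos[of "f x"] by simp
  then show ?thesis
    unfolding smooth_step_def using assms by (intro elementary_intros)
qed

lemma smooth_step_0: "x \<le> 0 \<Longrightarrow> smooth_step x = 0"
  by (simp add: smooth_step_def flat_eq_0)

lemma smooth_step_1: "x \<ge> 1 \<Longrightarrow> smooth_step x = 1"
  using flat_pos[of x 0] by (simp add: smooth_step_def flat_eq_0)

lemma smooth_step_nonneg: "smooth_step x \<ge> 0" and smooth_step_le_1: "smooth_step x \<le> 1"
  using smooth_step_denominator_pos[of x] flat_nonneg[of 0 x] flat_nonneg[of 0 "1 - x"]
  by (auto simp: smooth_step_def divide_simps)

lemma deriv_eq_on_open:
  fixes f g :: "real \<Rightarrow> real"
  assumes "(g has_real_derivative D) (at x)" "open S" "x \<in> S" "\<And>y. y \<in> S \<Longrightarrow> f y = g y"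
  shows "deriv f x = D"
  by (rule DERIV_imp_deriv, rule has_field_derivative_transform_within_open[OF assms(1-3)])
     (simp add: assms(4))

text \<open>
  A single test function would have to cut off \<open>1 / (x + z)\<close> to the left of \<open>0\<close>, and the effect of
  that cut-off could only be discarded if \<open>\<xi>\<close> were known to vanish there. Replacing \<open>x\<close> by a
  smoothed positive part, flattened on the scale \<open>1 / n\<close>, makes the unwanted contribution disappear
  in the limit instead.
\<close>

lemma resolvent_test_functions:
  fixes z :: real
  assumes z: "z > 0"
  obtains \<phi> :: "nat \<Rightarrow> real \<Rightarrow> real" and K :: real where
    "\<And>n. test_function (\<phi> n)"
    "\<And>n. elementary (\<phi> n)"
    "\<And>n x. 0 \<le> x \<Longrightarrow> x \<le> real n \<Longrightarrow> \<phi> n x = 1 / (x + z)"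
    "\<And>n x. \<bar>deriv (\<phi> n) x\<bar> \<le> K"
    "\<And>x. x > 0 \<Longrightarrow> (\<lambda>n. deriv (\<phi> n) x) \<longlonglongrightarrow> - (1 / (x + z)\<^sup>2)"
    "\<And>x. x < 0 \<Longrightarrow> (\<lambda>n. deriv (\<phi> n) x) \<longlonglongrightarrow> 0"
proof -
  \<comment> \<open>The smoothed positive part: the identity on \<open>x \<ge> 0\<close>, zero on
    \<open>x \<le> -1\<close>, never below \<open>-1\<close>. Rescaled to
    \<open>m (N * x) / N\<close> it has derivative \<open>deriv m (N * x)\<close>, so the slope
    bound does not depend on the scale.\<close>
  define m where "m = (\<lambda>x. x * smooth_step (x + 1))"
  have el_s: "elementary smooth_step"
    using elementary_smooth_step[OF elementary.ident] by simp
  have el_m': "elementary (\<lambda>x. f x * smooth_step (f x + 1))" if "elementary f" for f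
    using that by (intro elementary_intros elementary_smooth_step)
  have el_m: "elementary m"
    unfolding m_def by (rule el_m'[OF elementary.ident])
  have ds: "deriv smooth_step x = 0" if "x < 0 \<or> 1 < x" for x
  proof (cases "x < 0")
    case True
    then show ?thesis
      by (intro deriv_eq_on_open[where S = "{..<0}" and g = "\<lambda>_. 0"]) (auto simp: smooth_step_0)
  next
    case False
    with that show ?thesis
      by (intro deriv_eq_on_open[where S = "{1<..}" and g = "\<lambda>_. 1"]) (auto simp: smooth_step_1)
  qed
  obtain C1 where C1: "\<And>x. \<bar>deriv smooth_step x\<bar> \<le> C1"
    by (rule elementary_deriv_bounded_outside[OF el_s, of 0 1 0]) (auto simp: ds)
  have m_pos: "m x = x" if "x \<ge> 0" for x
    using that by (simp add: m_def smooth_step_1)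
  have m_neg: "m x = 0" if "x \<le> -1" for x
    using that by (simp add: m_def smooth_step_0)
  have m_ge: "m x \<ge> -1" for x
  proof -
    consider "x \<le> -1" | "x \<ge> 0" | "-1 \<le> x" "x \<le> 0" by linarith
    then show ?thesis
    proof cases
      case 3
      then have "\<bar>x\<bar> * smooth_step (x + 1) \<le> 1 * 1"
        using smooth_step_le_1 smooth_step_nonneg by (intro mult_mono) auto
      with 3 show ?thesis by (simp add: m_def)
    qed (auto simp: m_pos m_neg)
  qed
  have dm_pos: "deriv m x = 1" if "x > 0" for x
    by (rule deriv_eq_on_open[where S = "{0<..}" and g = "\<lambda>x. x"]) (use that in \<open>auto simp: m_pos\<close>)
  have dm_neg: "deriv m x = 0" if "x < -1" for x
    by (rule deriv_eq_on_open[where S = "{..<-1}" and g = "\<lambda>x. 0"]) (use that in \<open>auto simp: m_neg\<close>)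
  have "\<bar>deriv m x\<bar> \<le> 1" if "x < -1 \<or> 0 < x" for x
    using that dm_pos[of x] dm_neg[of x] by auto
  from elementary_deriv_bounded_outside[OF el_m this]
  obtain C2 where C2: "\<And>x. \<bar>deriv m x\<bar> \<le> C2" by blast
  have C1': "C1 \<ge> 0" using C1[of 0] by linarith
  \<comment> \<open>\<open>N \<ge> 2 / z\<close> keeps \<open>z + m (N * x) / N\<close> above
    \<open>z / 2\<close>; the summand 1 gives \<open>N \<ge> 1\<close>, which makes the bound for
    the slope of the cut-off uniform.\<close>
  define n0 where "n0 = nat \<lceil>2 / z\<rceil> + 1"
  define N where "N = (\<lambda>n. real (n + n0))"
  have N2: "N n \<ge> 2 / z" and N1: "N n \<ge> 1" for n
    unfolding N_def n0_def by linarith+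
  have N0: "N n > 0" for n using N1[of n] by linarith
  \<comment> \<open>The cut-off is 1 for \<open>\<bar>x\<bar> \<le> N\<close> and 0 for
    \<open>\<bar>x\<bar> \<ge> 2 * N\<close>. Its transition zones have length \<open>N\<close>, so
    its slope is of order \<open>1 / N\<close> and disappears in the limit.\<close>
  define c where "c = (\<lambda>n x. smooth_step (2 - x / N n) * smooth_step (2 + x / N n))"
  define w where "w = (\<lambda>n x. inverse (z + m (N n * x) / N n))"
  define \<phi> where "\<phi> = (\<lambda>n x. c n x * w n x)"
  have den: "z + m (N n * x) / N n \<ge> z / 2" for n x
  proof -
    have "m (N n * x) / N n \<ge> (-1) / N n"
      using m_ge N0[of n] by (intro divide_right_mono) (auto simp: less_imp_le)
    moreover have "1 / N n \<le> z / 2"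
      using N2[of n] N0[of n] z by (simp add: field_simps)
    ultimately show ?thesis by linarith
  qed
  have den0: "z + m (N n * x) / N n \<noteq> 0" for n x
    using den[of n x] z by linarith
  have w_bd: "0 \<le> w n x" "w n x \<le> 2 / z" for n x
  proof -
    have "0 \<le> z + m (N n * x) / N n" using den[of n x] z by linarith
    then show "0 \<le> w n x" by (simp add: w_def)
    have "inverse (z + m (N n * x) / N n) \<le> inverse (z / 2)"
      using den[of n x] z by (intro le_imp_inverse_le) auto
    then show "w n x \<le> 2 / z" by (simp add: w_def)
  qed
  have c_bd: "0 \<le> c n x" "c n x \<le> 1" for n x
    using smooth_step_nonneg smooth_step_le_1 unfolding c_def by (auto intro!: mult_le_one)
  have el_c: "elementary (c n)" for n
    unfolding c_def using N0[of n]
    by (intro elementary_intros elementary_smooth_step) auto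
  have el_w: "elementary (w n)" for n
    unfolding w_def using den0[of n] N0[of n] unfolding m_def
    by (intro elementary_intros elementary_smooth_step) auto
  have el: "elementary (\<phi> n)" for n
    unfolding \<phi>_def by (intro elementary.mult el_c el_w)
  define c' where "c' = (\<lambda>n x. deriv smooth_step (2 + x / N n) / N n * smooth_step (2 - x / N n)
      - deriv smooth_step (2 - x / N n) / N n * smooth_step (2 + x / N n))"
  have dc: "(c n has_real_derivative c' n x) (at x)" for n x
  proof -
    have "((\<lambda>x. smooth_step (2 - x / N n)) has_real_derivative
        deriv smooth_step (2 - x / N n) * (- (1 / N n))) (at x)"
      by (rule DERIV_chain2[OF elementary_DERIV[OF el_s]])
         (use N0[of n] in \<open>auto intro!: derivative_eq_intros\<close>)
    moreover have "((\<lambda>x. smooth_step (2 + x / N n)) has_real_derivative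
        deriv smooth_step (2 + x / N n) * (1 / N n)) (at x)"
      by (rule DERIV_chain2[OF elementary_DERIV[OF el_s]])
         (use N0[of n] in \<open>auto intro!: derivative_eq_intros\<close>)
    ultimately show ?thesis
      unfolding c_def c'_def by (auto intro!: derivative_eq_intros)
  qed
  have c'_bd: "\<bar>c' n x\<bar> \<le> 2 * C1 / N n" for n x
  proof -
    have *: "\<bar>deriv smooth_step u / N n * smooth_step v\<bar> \<le> C1 / N n * 1" for u v
      unfolding abs_mult using C1[of u] C1' N0[of n] smooth_step_le_1[of v] smooth_step_nonneg[of v]
      by (intro mult_mono) (auto intro!: divide_right_mono)
    show ?thesis
      unfolding c'_def using *[of "2 + x / N n" "2 - x / N n"] *[of "2 - x / N n" "2 + x / N n"]
      by linarith
  qed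
  have dw: "(w n has_real_derivative - (w n x * deriv m (N n * x) * w n x)) (at x)" for n x
  proof -
    have "((\<lambda>x. m (N n * x)) has_real_derivative deriv m (N n * x) * N n) (at x)"
      by (rule DERIV_chain2[OF elementary_DERIV[OF el_m]]) (auto intro!: derivative_eq_intros)
    then have "((\<lambda>x. z + m (N n * x) / N n) has_real_derivative deriv m (N n * x)) (at x)"
      using N0[of n] by (auto intro!: derivative_eq_intros)
    from DERIV_inverse_fun[OF this den0] show ?thesis
      unfolding w_def by (simp add: power2_eq_square mult_ac)
  qed
  have d\<phi>: "deriv (\<phi> n) x = c' n x * w n x - c n x * (w n x)\<^sup>2 * deriv m (N n * x)" for n x
    unfolding \<phi>_def
    by (rule DERIV_imp_deriv) (use DERIV_mult[OF dc dw] in \<open>simp add: power2_eq_square mult_ac\<close>)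
  have c'w: "\<bar>c' n x * w n x\<bar> \<le> 2 * C1 / N n * (2 / z)" for n x
    unfolding abs_mult using c'_bd[of n x] w_bd[of n x] by (intro mult_mono) auto
  have lim1: "(\<lambda>n. c' n x * w n x) \<longlonglongrightarrow> 0" for x
  proof (rule Lim_null_comparison[OF always_eventually])
    show "\<forall>n. norm (c' n x * w n x) \<le> 2 * C1 / N n * (2 / z)" using c'w by simp
    have "(\<lambda>n. inverse (real (n + n0))) \<longlonglongrightarrow> 0"
      using LIMSEQ_ignore_initial_segment[OF lim_inverse_n, of n0] by simp
    then have "(\<lambda>n. 2 * C1 * inverse (N n) * (2 / z)) \<longlonglongrightarrow> 2 * C1 * 0 * (2 / z)"
      unfolding N_def by (intro tendsto_intros)
    then show "(\<lambda>n. 2 * C1 / N n * (2 / z)) \<longlonglongrightarrow> 0" by (simp add: divide_inverse)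
  qed
  have val: "c n x = 1" "w n x = 1 / (x + z)" if "0 \<le> x" "x \<le> N n" for n x
    using that N0[of n] unfolding c_def w_def
    by (auto simp: smooth_step_1 m_pos field_simps)
  show ?thesis
  proof (rule that)
    show "elementary (\<phi> n)" for n by (rule el)
    show "test_function (\<phi> n)" for n
    proof (rule elementary_test_function[OF el])
      fix x assume "2 * N n < \<bar>x\<bar>"
      then have "2 - x / N n \<le> 0 \<or> 2 + x / N n \<le> 0"
        using N0[of n] by (auto simp: field_simps abs_if split: if_splits)
      then show "\<phi> n x = 0" unfolding \<phi>_def c_def by (auto simp: smooth_step_0)
    qed
    show "\<phi> n x = 1 / (x + z)" if "0 \<le> x" "x \<le> real n" for n x
      using val[of x n] that by (simp add: \<phi>_def N_def)
    show "\<bar>deriv (\<phi> n) x\<bar> \<le> 4 * C1 / z + (2 / z)\<^sup>2 * C2" for n x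
    proof -
      have "\<bar>c n x * (w n x)\<^sup>2 * deriv m (N n * x)\<bar> \<le> 1 * (2 / z)\<^sup>2 * C2"
        unfolding abs_mult using c_bd[of n x] power_mono[OF w_bd(2,1), of n x 2] C2[of "N n * x"]
        by (intro mult_mono) auto
      moreover have "\<bar>c' n x * w n x\<bar> \<le> 2 * C1 / 1 * (2 / z)"
        by (rule order_trans[OF c'w]) (use N1[of n] C1' z in \<open>intro mult_right_mono divide_left_mono; simp\<close>)
      ultimately show ?thesis unfolding d\<phi> by simp
    qed
    show "(\<lambda>n. deriv (\<phi> n) x) \<longlonglongrightarrow> - (1 / (x + z)\<^sup>2)" if x: "x > 0" for x
    proof -
      obtain k :: nat where k: "real k \<ge> x" using real_arch_simple by blast
      have "eventually (\<lambda>n. c' n x * w n x - 1 / (x + z)\<^sup>2 = deriv (\<phi> n) x) sequentially"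
        using eventually_ge_at_top[of k]
      proof eventually_elim
        case (elim n)
        then have "x \<le> N n" using k by (simp add: N_def)
        moreover have "deriv m (N n * x) = 1" using x N0[of n] by (intro dm_pos) simp
        ultimately show ?case using val[of x n] x by (simp add: d\<phi> power_divide)
      qed
      then show ?thesis
        using Lim_transform_eventually[OF tendsto_diff[OF lim1 tendsto_const]] by fastforce
    qed
    show "(\<lambda>n. deriv (\<phi> n) x) \<longlonglongrightarrow> 0" if x: "x < 0" for x
    proof -
      \<comment> \<open>From this index on \<open>N * x < -1\<close>, where \<open>m\<close> is
        locally constant, so only the slope of the cut-off is left.\<close>
      obtain k :: nat where k: "real k > 1 / (- x)" using reals_Archimedean2 by blast
      have "eventually (\<lambda>n. c' n x * w n x = deriv (\<phi> n) x) sequentially"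
        using eventually_ge_at_top[of k]
      proof eventually_elim
        case (elim n)
        then have "1 / (- x) < N n" using k by (simp add: N_def)
        then have "deriv m (N n * x) = 0" using x by (intro dm_neg) (simp add: field_simps)
        then show ?case by (simp add: d\<phi>)
      qed
      then show ?thesis by (rule Lim_transform_eventually[OF lim1])
    qed
  qed
qed

section \<open>Polynomials of symmetric operators\<close>

lemmas blinfun_compose_bilinear =
  bounded_bilinear.add_left[OF bounded_bilinear_blinfun_compose]
  bounded_bilinear.add_right[OF bounded_bilinear_blinfun_compose]
  bounded_bilinear.diff_left[OF bounded_bilinear_blinfun_compose]
  bounded_bilinear.diff_right[OF bounded_bilinear_blinfun_compose]
  bounded_bilinear.minus_left[OF bounded_bilinear_blinfun_compose]
  bounded_bilinear.minus_right[OF bounded_bilinear_blinfun_compose]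
  bounded_bilinear.scaleR_left[OF bounded_bilinear_blinfun_compose]
  bounded_bilinear.scaleR_right[OF bounded_bilinear_blinfun_compose]
  bounded_bilinear.zero_left[OF bounded_bilinear_blinfun_compose]
  bounded_bilinear.zero_right[OF bounded_bilinear_blinfun_compose]
  bounded_bilinear.sum_right[OF bounded_bilinear_blinfun_compose]

lemma poly_op_le_degree:
  "degree p \<le> n \<Longrightarrow> poly_op p A = (\<Sum>i\<le>n. coeff p i *\<^sub>R ((((o\<^sub>L) A) ^^ i) id_blinfun))"
  unfolding poly_op_def by (intro sum.mono_neutral_left) (auto simp: coeff_eq_0)

lemma poly_op_add: "poly_op (p + q) A = poly_op p A + poly_op q A"
proof -
  let ?n = "max (degree p) (degree q)"
  have "poly_op (p + q) A = (\<Sum>i\<le>?n. coeff (p + q) i *\<^sub>R ((((o\<^sub>L) A) ^^ i) id_blinfun))"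
    by (rule poly_op_le_degree) (rule degree_add_le_max)
  then show ?thesis
    by (simp add: poly_op_le_degree[of p ?n] poly_op_le_degree[of q ?n] scaleR_add_left sum.distrib)
qed

lemma poly_op_smult: "poly_op (smult c p) A = c *\<^sub>R poly_op p A"
  using poly_op_le_degree[of "smult c p" "degree p" A]
  by (simp add: poly_op_def[of p] scaleR_sum_right degree_smult_le)

lemma poly_op_0 [simp]: "poly_op 0 A = 0"
  by (simp add: poly_op_def)

lemma poly_op_pCons: "poly_op (pCons c p) A = c *\<^sub>R id_blinfun + (A o\<^sub>L poly_op p A)"
proof -
  have "poly_op (pCons c p) A
      = (\<Sum>i\<le>Suc (degree p). coeff (pCons c p) i *\<^sub>R ((((o\<^sub>L) A) ^^ i) id_blinfun))"
    by (rule poly_op_le_degree) (rule degree_pCons_le)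
  also have "\<dots> = c *\<^sub>R id_blinfun
      + (\<Sum>i\<le>degree p. coeff p i *\<^sub>R (A o\<^sub>L ((((o\<^sub>L) A) ^^ i) id_blinfun)))"
    by (subst sum.atMost_Suc_shift) simp
  also have "(\<Sum>i\<le>degree p. coeff p i *\<^sub>R (A o\<^sub>L ((((o\<^sub>L) A) ^^ i) id_blinfun))) = A o\<^sub>L poly_op p A"
    by (simp add: poly_op_def blinfun_compose_bilinear)
  finally show ?thesis .
qed

lemma poly_op_const: "poly_op [:c:] A = c *\<^sub>R id_blinfun"
  by (simp add: poly_op_pCons blinfun_compose_bilinear)

lemma poly_op_diff: "poly_op (p - q) A = poly_op p A - poly_op q A"
  using poly_op_add[of p "smult (-1) q" A] unfolding poly_op_smult by simp

lemma blinfun_compose_id [simp]: "id_blinfun o\<^sub>L T = T" "T o\<^sub>L id_blinfun = T"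
  by (auto intro: blinfun_eqI)

lemma blinfun_compose_assoc: "(S o\<^sub>L T) o\<^sub>L U = S o\<^sub>L (T o\<^sub>L U)"
  by (auto intro: blinfun_eqI)

lemma poly_op_linear: "poly_op [:c, 1:] A = A + c *\<^sub>R id_blinfun"
  by (simp add: poly_op_pCons blinfun_compose_bilinear add.commute)

lemma poly_op_mult: "poly_op (p * q) A = poly_op p A o\<^sub>L poly_op q A"
proof (induction p)
  case (pCons c p)
  have "poly_op (pCons c p * q) A = c *\<^sub>R poly_op q A + (A o\<^sub>L (poly_op p A o\<^sub>L poly_op q A))"
    by (simp add: poly_op_add poly_op_smult poly_op_pCons pCons.IH)
  then show ?case
    by (simp add: poly_op_pCons blinfun_compose_bilinear
        blinfun_compose_assoc)
qed (simp add: blinfun_compose_bilinear)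

lemma poly_op_commute: "poly_op p A o\<^sub>L poly_op q A = poly_op q A o\<^sub>L poly_op p A"
  by (metis poly_op_mult mult.commute)

definition symmetric_op :: "('a::real_inner \<Rightarrow>\<^sub>L 'a) \<Rightarrow> bool" where
  "symmetric_op A \<longleftrightarrow> (\<forall>x y. inner (A x) y = inner x (A y))"

lemma symmetric_opD: "symmetric_op A \<Longrightarrow> inner (A x) y = inner x (A y)"
  by (simp add: symmetric_op_def)

lemma symmetric_op_poly_op:
  assumes "symmetric_op A"
  shows "symmetric_op (poly_op p A)"
proof (induction p)
  case (pCons c p)
  have "A o\<^sub>L poly_op p A = poly_op p A o\<^sub>L A"
    using poly_op_commute[of "[:0, 1:]" A p] by (simp add: poly_op_linear)
  then have comm: "A (poly_op p A x) = poly_op p A (A x)" for x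
    by (metis blinfun_apply_blinfun_compose)
  have "inner (A (poly_op p A x)) y = inner x (A (poly_op p A y))" for x y
    using symmetric_opD[OF assms, of "poly_op p A x" y] symmetric_opD[OF pCons.IH, of x "A y"]
    by (simp add: comm)
  then show ?case
    by (simp add: symmetric_op_def poly_op_pCons blinfun.add_left blinfun.scaleR_left inner_simps
        del: scaleR_cancel_left)
qed (simp add: symmetric_op_def)

section \<open>Coercive operators and the spectrum of a positive operator\<close>

definition invertible_op :: "('a::real_normed_vector \<Rightarrow>\<^sub>L 'a) \<Rightarrow> bool" where
  "invertible_op T \<longleftrightarrow> (\<exists>R. R o\<^sub>L T = id_blinfun \<and> T o\<^sub>L R = id_blinfun)"

lemma op_spectrum_iff: "z \<in> op_spectrum A \<longleftrightarrow> \<not> invertible_op (A - z *\<^sub>R id_blinfun)"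
  by (simp add: op_spectrum_def invertible_op_def)

lemma invertible_op_compose:
  assumes "invertible_op S" "invertible_op T"
  shows "invertible_op (S o\<^sub>L T)"
proof -
  obtain S' T' where S: "S' o\<^sub>L S = id_blinfun" "S o\<^sub>L S' = id_blinfun"
    and T: "T' o\<^sub>L T = id_blinfun" "T o\<^sub>L T' = id_blinfun"
    using assms by (auto simp: invertible_op_def)
  have "(T' o\<^sub>L S') o\<^sub>L (S o\<^sub>L T) = T' o\<^sub>L ((S' o\<^sub>L S) o\<^sub>L T)"
    and "(S o\<^sub>L T) o\<^sub>L (T' o\<^sub>L S') = S o\<^sub>L ((T o\<^sub>L T') o\<^sub>L S')"
    by (simp_all add: blinfun_compose_assoc)
  then show ?thesis
    unfolding invertible_op_def using S T by (intro exI[of _ "T' o\<^sub>L S'"]) simp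
qed

lemma invertible_op_bounded_below:
  assumes "invertible_op T"
  obtains c where "c > 0" "\<And>x. norm x \<le> c * norm (T x)"
proof -
  obtain R where "R o\<^sub>L T = id_blinfun" using assms by (auto simp: invertible_op_def)
  then have R: "R (T x) = x" for x by (metis blinfun_apply_blinfun_compose blinfun_apply_id_blinfun)
  show ?thesis
  proof (rule that)
    show "norm R + 1 > 0" using norm_ge_zero[of R] by linarith
    show "norm x \<le> (norm R + 1) * norm (T x)" for x
      using norm_blinfun[of R "T x"] by (simp add: R distrib_right add_increasing2)
  qed
qed

text \<open>The Lax-Milgram argument: for small \<open>e\<close> the map sending \<open>x\<close> to
  \<open>x - e (T x - y)\<close> is a contraction, and its fixed point solves
  \<open>T x = y\<close>. Coercivity also gives injectivity and the norm of the inverse.\<close>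

lemma coercive_inverse:
  fixes T :: "'a::{real_inner, banach} \<Rightarrow>\<^sub>L 'a"
  assumes c: "c > 0" and coer: "\<And>x. c * (norm x)\<^sup>2 \<le> inner (T x) x"
  obtains R where "R o\<^sub>L T = id_blinfun" "T o\<^sub>L R = id_blinfun" "norm R \<le> 1 / c"
proof -
  have lower: "c * norm x \<le> norm (T x)" for x
  proof (cases "x = 0")
    case False
    have "c * (norm x)\<^sup>2 \<le> norm (T x) * norm x"
      using coer[of x] norm_cauchy_schwarz[of "T x" x] by linarith
    with False show ?thesis by (simp add: power2_eq_square)
  qed simp
  define M where "M = norm T + c"
  have M: "M > 0" "norm T \<le> M" "c \<le> M" using c norm_ge_zero[of T] unfolding M_def by linarith+
  \<comment> \<open>The squared contraction factor is at most \<open>1 - 2 e c + e^2 M^2\<close>.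
    This choice minimises it, with value \<open>1 - c^2 / M^2\<close>; \<open>M\<close> was enlarged
    by \<open>c\<close> so that it is positive and the value is nonnegative.\<close>
  define e where "e = c / M\<^sup>2"
  have e: "e > 0" using c M by (simp add: e_def)
  define k where "k = sqrt (1 - c\<^sup>2 / M\<^sup>2)"
  have cM: "c\<^sup>2 \<le> M\<^sup>2" using c M by (intro power_mono) auto
  have k: "0 \<le> k" "k < 1" using c M cM by (auto simp: k_def)
  have k2: "k\<^sup>2 = 1 - c\<^sup>2 / M\<^sup>2" using cM M by (simp add: k_def)
  have contr: "norm (x - e *\<^sub>R T x) \<le> k * norm x" for x
  proof (rule power2_le_imp_le)
    have "(norm (T x))\<^sup>2 \<le> (M * norm x)\<^sup>2"
      using norm_blinfun[of T x] M(2) mult_right_mono[OF M(2), of "norm x"]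
      by (intro power_mono) auto
    then have *: "e\<^sup>2 * (norm (T x))\<^sup>2 \<le> e\<^sup>2 * (M * norm x)\<^sup>2" by (rule mult_left_mono) simp
    have **: "2 * e * (c * (norm x)\<^sup>2) \<le> 2 * e * inner (T x) x"
      using coer[of x] e by (intro mult_left_mono) auto
    have "(norm (x - e *\<^sub>R T x))\<^sup>2 = (norm x)\<^sup>2 - 2 * e * inner (T x) x + e\<^sup>2 * (norm (T x))\<^sup>2"
      unfolding power2_norm_eq_inner
      by (simp add: inner_simps inner_commute[of x "T x"] power2_eq_square
          right_diff_distrib)
    also have "\<dots> \<le> (norm x)\<^sup>2 - 2 * e * (c * (norm x)\<^sup>2) + e\<^sup>2 * (M * norm x)\<^sup>2"
      using * ** by linarith
    also have "\<dots> = (k * norm x)\<^sup>2"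
      using M(1) by (simp add: e_def power_mult_distrib k2) (simp add: field_simps power2_eq_square)
    finally show "(norm (x - e *\<^sub>R T x))\<^sup>2 \<le> (k * norm x)\<^sup>2" .
  qed (use k in simp)
  have "\<exists>x. T x = y" for y
  proof -
    have "\<exists>!x. x - e *\<^sub>R (T x - y) = x"
    proof (rule banach_fix_type[OF k])
      show "\<forall>u v. dist (u - e *\<^sub>R (T u - y)) (v - e *\<^sub>R (T v - y)) \<le> k * dist u v"
      proof (intro allI)
        fix u v
        have "(u - e *\<^sub>R (T u - y)) - (v - e *\<^sub>R (T v - y)) = (u - v) - e *\<^sub>R T (u - v)"
          by (simp add: blinfun.diff_right algebra_simps)
        then show "dist (u - e *\<^sub>R (T u - y)) (v - e *\<^sub>R (T v - y)) \<le> k * dist u v"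
          using contr[of "u - v"] by (simp only: dist_norm)
      qed
    qed
    then have "\<exists>x. x - e *\<^sub>R (T x - y) = x" by (rule ex1_implies_ex)
    then obtain x where "x - e *\<^sub>R (T x - y) = x" ..
    then have "T x = y" using e by simp
    then show ?thesis ..
  qed
  then obtain r where r: "\<And>y. T (r y) = y" by metis
  have inj: "u = v" if "T u = T v" for u v
    using lower[of "u - v"] that c by (simp add: blinfun.diff_right mult_le_0_iff)
  have bl: "bounded_linear r"
  proof (rule bounded_linear_intro[where K = "1 / c"])
    show "r (x + y) = r x + r y" for x y
      by (rule inj) (simp add: r blinfun.add_right)
    show "r (a *\<^sub>R x) = a *\<^sub>R r x" for a x
      by (rule inj) (simp add: r blinfun.scaleR_right)
    show "norm (r x) \<le> norm x * (1 / c)" for x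
      using lower[of "r x"] c by (simp add: r field_simps)
  qed
  show ?thesis
  proof (rule that)
    show "Blinfun r o\<^sub>L T = id_blinfun"
      by (intro blinfun_eqI, rule inj) (simp add: bounded_linear_Blinfun_apply[OF bl] r)
    show "T o\<^sub>L Blinfun r = id_blinfun"
      by (intro blinfun_eqI) (simp add: bounded_linear_Blinfun_apply[OF bl] r)
    show "norm (Blinfun r) \<le> 1 / c"
    proof (rule norm_blinfun_bound)
      show "norm (Blinfun r y) \<le> 1 / c * norm y" for y
        using lower[of "r y"] c by (simp add: bounded_linear_Blinfun_apply[OF bl] r field_simps)
    qed (use c in simp)
  qed
qed

lemma invertible_op_coercive:
  fixes T :: "'a::{real_inner, banach} \<Rightarrow>\<^sub>L 'a"
  assumes "c > 0" "\<And>x. c * (norm x)\<^sup>2 \<le> inner (T x) x"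
  shows "invertible_op T"
  using coercive_inverse[OF assms] unfolding invertible_op_def by metis

text \<open>Below 0 the operator \<open>A - z\<close> is coercive with constant \<open>- z\<close>;
  above \<open>norm A\<close> its negative is coercive with constant
  \<open>z - norm A\<close>.\<close>

lemma op_spectrum_positive_subset:
  fixes A :: "'a::{real_inner, banach} \<Rightarrow>\<^sub>L 'a"
  assumes pos: "\<And>x. inner (A x) x \<ge> 0"
  shows "op_spectrum A \<subseteq> {0..norm A}"
proof (rule ccontr)
  assume "\<not> ?thesis"
  then obtain z where z: "\<not> invertible_op (A - z *\<^sub>R id_blinfun)" "z < 0 \<or> norm A < z"
    unfolding op_spectrum_iff[symmetric] by force
  from z(2) show False
  proof
    assume "z < 0"
    then have "invertible_op (A - z *\<^sub>R id_blinfun)"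
      using pos by (intro invertible_op_coercive[of "- z"])
        (auto simp: blinfun.diff_left blinfun.scaleR_left inner_simps power2_norm_eq_inner)
    with z show False by simp
  next
    assume "norm A < z"
    have "inner (A x) x \<le> norm A * (norm x)\<^sup>2" for x
      using norm_cauchy_schwarz[of "A x" x] mult_right_mono[OF norm_blinfun[of A x], of "norm x"]
      by (simp add: power2_eq_square)
    then have "invertible_op ((-1) *\<^sub>R (A - z *\<^sub>R id_blinfun))"
      using \<open>norm A < z\<close>
      by (intro invertible_op_coercive[of "z - norm A"])
        (auto simp: blinfun.diff_left blinfun.scaleR_left blinfun.minus_left inner_simps
           power2_norm_eq_inner algebra_simps)
    moreover have "invertible_op ((-1) *\<^sub>R (id_blinfun :: 'a \<Rightarrow>\<^sub>L 'a))"
      unfolding invertible_op_def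
      by (intro exI[of _ "(-1) *\<^sub>R id_blinfun"])
         (simp add: blinfun_compose_bilinear)
    ultimately have "invertible_op (((-1) *\<^sub>R id_blinfun) o\<^sub>L ((-1) *\<^sub>R (A - z *\<^sub>R id_blinfun)))"
      by (intro invertible_op_compose)
    with z show False by (simp add: blinfun_compose_bilinear)
  qed
qed

section \<open>Roots of polynomials in the spectrum, and the norm of
  \<open>poly_op p A\<close>\<close>

lemma map_poly_of_real_add:
  "map_poly of_real (p + q) = map_poly of_real p + (map_poly of_real q :: 'a::real_algebra_1 poly)"
  by (intro poly_eqI) (simp add: coeff_map_poly)

lemma map_poly_of_real_mult:
  "map_poly of_real (p * q) = map_poly of_real p * (map_poly of_real q :: 'a::{real_algebra_1, comm_semiring_1} poly)"
  by (intro poly_eqI) (simp add: coeff_map_poly coeff_mult)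

lemma poly_map_poly_of_real:
  "poly (map_poly of_real p) (of_real x :: 'a::{real_algebra_1, comm_semiring_1}) = of_real (poly p x)"
  by (induction p) (auto simp: map_poly_pCons)

text \<open>Spectral mapping, without complexification: a real polynomial factors into linear factors and
  quadratic factors without real roots, and the latter are coercive at \<open>A\<close>.\<close>

lemma not_invertible_poly_op_root:
  fixes A :: "'a::{real_inner, banach} \<Rightarrow>\<^sub>L 'a"
  assumes sym: "symmetric_op A" and "p \<noteq> 0" "\<not> invertible_op (poly_op p A)"
  shows "\<exists>r\<in>op_spectrum A. poly p r = 0"
  using assms(2,3)
proof (induction "degree p" arbitrary: p rule: less_induct)
  case less
  show ?case
  proof (cases "degree p = 0")
    case True
    then obtain c where c: "p = [:c:]" by (rule degree_eq_zeroE)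
    with less.prems(1) have "c \<noteq> 0" by auto
    then have "invertible_op (poly_op p A)"
      unfolding invertible_op_def c poly_op_const
      by (intro exI[of _ "(1 / c) *\<^sub>R id_blinfun"])
         (simp add: blinfun_compose_bilinear)
    with less.prems(2) show ?thesis by simp
  next
    case False
    let ?P = "map_poly complex_of_real p"
    have "degree ?P = degree p" by (rule degree_map_poly) simp
    then have "\<not> constant (poly ?P)" using False constant_degree by metis
    then obtain w where w: "poly ?P w = 0" using fundamental_theorem_of_algebra by blast
    show ?thesis
    proof (cases "w \<in> \<real>")
      case True
      then obtain r where r: "w = of_real r" by (auto elim: Reals_cases)
      then have "poly p r = 0" using w by (simp add: poly_map_poly_of_real)
      then obtain s where s: "p = [:- r, 1:] * s" by (auto simp: poly_eq_0_iff_dvd elim: dvdE)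
      show ?thesis
      proof (cases "r \<in> op_spectrum A")
        case True
        then show ?thesis using \<open>poly p r = 0\<close> by blast
      next
        case False
        \<comment> \<open>The linear factor is invertible at \<open>A\<close>, so the cofactor must
          fail to be, and it has smaller degree.\<close>
        then have "\<not> invertible_op (poly_op s A)"
          using less.prems(2) invertible_op_compose[of "A - r *\<^sub>R id_blinfun" "poly_op s A"]
          unfolding s poly_op_mult poly_op_linear by (auto simp: op_spectrum_iff)
        moreover have "s \<noteq> 0" using less.prems(1) s by auto
        moreover have "degree s < degree p"
          using \<open>s \<noteq> 0\<close> unfolding s by (subst degree_mult_eq) auto
        ultimately obtain t where "t \<in> op_spectrum A" "poly s t = 0"
          using less.hyps[of s] by blast
        then show ?thesis unfolding s by (intro bexI[of _ t]) auto
      qed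
    next
      case False
      define a b where "a = Re w" and "b = Im w"
      have b: "b \<noteq> 0" using False by (simp add: b_def complex_is_Real_iff)
      \<comment> \<open>This is \<open>(x - a)^2 + b^2\<close>, the real quadratic with roots
        \<open>w\<close> and its conjugate. At \<open>A\<close> it is \<open>b^2\<close> plus the
        square of a symmetric operator, hence coercive with constant \<open>b^2\<close>.\<close>
      define d where "d = [:a\<^sup>2 + b\<^sup>2, - 2 * a, 1:]"
      have dw: "poly (map_poly complex_of_real d) w = 0"
        by (simp add: d_def map_poly_pCons a_def b_def complex_eq_iff power2_eq_square algebra_simps)
      have d0: "degree d = 2" "d \<noteq> 0" by (auto simp: d_def)
      \<comment> \<open>The remainder is real of degree at most 1 and vanishes at the non-real
        \<open>w\<close>; the imaginary part kills its slope, then the real part its constant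
        term.\<close>
      have "p mod d = 0"
      proof (rule ccontr)
        assume nz: "p mod d \<noteq> 0"
        then have "degree (p mod d) < 2" using degree_mod_less[of d p] d0 by simp
        then have "p mod d = [:coeff (p mod d) 0, coeff (p mod d) 1:]"
          by (intro poly_eqI) (auto simp: coeff_pCons coeff_eq_0 split: nat.split)
        then obtain u v where uv: "p mod d = [:u, v:]" by blast
        have "map_poly complex_of_real p = map_poly of_real (p div d) * map_poly of_real d + map_poly of_real (p mod d)"
          by (metis div_mult_mod_eq map_poly_of_real_add map_poly_of_real_mult)
        then have "poly (map_poly complex_of_real (p mod d)) w = 0"
          using w dw by simp
        then have "complex_of_real u + w * complex_of_real v = 0"
          by (simp add: uv map_poly_pCons)
        then have "u = 0" "v = 0" using b by (auto simp: complex_eq_iff b_def)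
        with uv nz show False by simp
      qed
      then obtain s where s: "p = d * s" by (metis dvd_eq_mod_eq_0 dvdE)
      have "b\<^sup>2 * (norm x)\<^sup>2 \<le> inner (poly_op d A x) x" for x
      proof -
        have "d = [:b\<^sup>2:] + [:- a, 1:] * [:- a, 1:]"
          by (simp add: d_def power2_eq_square)
        then have "poly_op d A = b\<^sup>2 *\<^sub>R id_blinfun + (poly_op [:-a, 1:] A o\<^sub>L poly_op [:-a, 1:] A)"
          by (simp only: poly_op_add poly_op_const poly_op_mult)
        then have "inner (poly_op d A x) x
            = b\<^sup>2 * (norm x)\<^sup>2 + inner (poly_op [:-a, 1:] A (poly_op [:-a, 1:] A x)) x"
          by (simp add: blinfun.add_left blinfun.scaleR_left inner_simps power2_norm_eq_inner)
        moreover have "inner (poly_op [:-a, 1:] A (poly_op [:-a, 1:] A x)) x \<ge> 0"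
          using symmetric_opD[OF symmetric_op_poly_op[OF sym], of "[:-a,1:]" "poly_op [:-a, 1:] A x" x]
          by simp
        ultimately show ?thesis by simp
      qed
      then have "invertible_op (poly_op d A)" using b by (intro invertible_op_coercive[of "b\<^sup>2"]) auto
      then have "\<not> invertible_op (poly_op s A)"
        using less.prems(2) invertible_op_compose unfolding s poly_op_mult by blast
      moreover have "s \<noteq> 0" using less.prems(1) s by auto
      moreover have "degree s < degree p"
        using \<open>s \<noteq> 0\<close> d0 unfolding s by (subst degree_mult_eq) auto
      ultimately obtain t where "t \<in> op_spectrum A" "poly s t = 0"
        using less.hyps[of s] by blast
      then show ?thesis unfolding s by (intro bexI[of _ t]) auto
    qed
  qed
qed

text \<open>If \<open>N^2 - T^2\<close> with \<open>N = norm T\<close> were bounded below, then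
  \<open>N^2 \<parallel>x\<parallel>^2 - \<parallel>T x\<parallel>^2\<close> would dominate a fixed
  multiple of \<open>\<parallel>x\<parallel>^2\<close>, and \<open>T\<close> would have norm less
  than \<open>N\<close>. The vector \<open>v\<close> excludes the zero space, where every operator
  is invertible.\<close>

lemma symmetric_op_norm_not_invertible:
  fixes T :: "'a::{real_inner, banach} \<Rightarrow>\<^sub>L 'a"
  assumes sym: "symmetric_op T" and "(v::'a) \<noteq> 0"
  shows "\<not> invertible_op ((norm T)\<^sup>2 *\<^sub>R id_blinfun - (T o\<^sub>L T))"
proof
  let ?N = "norm T" and ?S = "(norm T)\<^sup>2 *\<^sub>R id_blinfun - (T o\<^sub>L T)"
  assume "invertible_op ?S"
  then obtain c where c: "c > 0" "\<And>x. norm x \<le> c * norm (?S x)"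
    using invertible_op_bounded_below by blast
  have S: "(norm (?S x))\<^sup>2 \<le> ?N\<^sup>2 * (?N\<^sup>2 * (norm x)\<^sup>2 - (norm (T x))\<^sup>2)" for x
  proof -
    have "(norm (T (T x)))\<^sup>2 \<le> (?N * norm (T x))\<^sup>2" by (intro power_mono norm_blinfun) auto
    moreover have "inner x (T (T x)) = inner (T x) (T x)" using symmetric_opD[OF sym] by simp
    then have "(norm (?S x))\<^sup>2 = ?N\<^sup>2 * ?N\<^sup>2 * (norm x)\<^sup>2 - 2 * ?N\<^sup>2 * (norm (T x))\<^sup>2 + (norm (T (T x)))\<^sup>2"
      by (simp add: blinfun.diff_left blinfun.scaleR_left power2_norm_eq_inner inner_simps
          inner_commute[of "T (T x)" x] algebra_simps)
    ultimately show ?thesis by (simp add: power_mult_distrib algebra_simps)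
  qed
  \<comment> \<open>The added 1 keeps the constant positive when \<open>norm T = 0\<close>, so that
    one may divide by it.\<close>
  define C where "C = c\<^sup>2 * ?N\<^sup>2 + 1"
  have C: "C \<ge> 1" by (simp add: C_def)
  have "(norm x)\<^sup>2 \<le> C * (?N\<^sup>2 * (norm x)\<^sup>2 - (norm (T x))\<^sup>2)" for x
  proof -
    have nn: "?N\<^sup>2 * (norm x)\<^sup>2 - (norm (T x))\<^sup>2 \<ge> 0"
      using power_mono[OF norm_blinfun[of T x], of 2] by (simp add: power_mult_distrib)
    have "(norm x)\<^sup>2 \<le> (c * norm (?S x))\<^sup>2" using c by (intro power_mono) auto
    also have "\<dots> \<le> c\<^sup>2 * (?N\<^sup>2 * (?N\<^sup>2 * (norm x)\<^sup>2 - (norm (T x))\<^sup>2))"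
      unfolding power_mult_distrib by (intro mult_left_mono S) simp
    also have "\<dots> \<le> C * (?N\<^sup>2 * (norm x)\<^sup>2 - (norm (T x))\<^sup>2)"
      using nn by (simp add: C_def algebra_simps)
    finally show ?thesis .
  qed
  then have bd: "(norm (T x))\<^sup>2 \<le> (?N\<^sup>2 - 1 / C) * (norm x)\<^sup>2" for x
    using C by (simp add: field_simps)
  have e: "norm (sgn v) = 1"
    using \<open>v \<noteq> 0\<close> by (simp add: norm_sgn)
  have N: "?N\<^sup>2 - 1 / C \<ge> 0"
    using order_trans[OF zero_le_power2 bd[of "sgn v"]] e by simp
  have "?N \<le> sqrt (?N\<^sup>2 - 1 / C)"
  proof (rule norm_blinfun_bound)
    show "norm (T x) \<le> sqrt (?N\<^sup>2 - 1 / C) * norm x" for x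
      by (rule power2_le_imp_le) (use bd[of x] N in \<open>auto simp: power_mult_distrib\<close>)
  qed (use N in simp)
  then have "?N\<^sup>2 \<le> ?N\<^sup>2 - 1 / C"
    using N power_mono[of ?N "sqrt (?N\<^sup>2 - 1 / C)" 2] by simp
  then show False using C by simp
qed

text \<open>With \<open>N = norm (poly_op p A)\<close> the polynomial \<open>N^2 - p^2\<close> is
  not invertible at \<open>A\<close>, so it has a root in the spectrum, and there
  \<open>\<bar>p\<bar> = N\<close>.\<close>

lemma norm_poly_op_attained:
  fixes A :: "'a::{real_inner, banach} \<Rightarrow>\<^sub>L 'a"
  assumes sym: "symmetric_op A" and v: "(v::'a) \<noteq> 0"
  shows "\<exists>r\<in>op_spectrum A. \<bar>poly p r\<bar> = norm (poly_op p A)"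
proof -
  have *: "\<exists>r\<in>op_spectrum A. \<bar>poly p r\<bar> = norm (poly_op p A)"
    if nz: "[:(norm (poly_op p A))\<^sup>2:] - p * p \<noteq> 0" for p
  proof -
    have "poly_op ([:(norm (poly_op p A))\<^sup>2:] - p * p) A
        = (norm (poly_op p A))\<^sup>2 *\<^sub>R id_blinfun - (poly_op p A o\<^sub>L poly_op p A)"
      by (simp only: poly_op_diff poly_op_const poly_op_mult)
    then have "\<not> invertible_op (poly_op ([:(norm (poly_op p A))\<^sup>2:] - p * p) A)"
      using symmetric_op_norm_not_invertible[OF symmetric_op_poly_op[OF sym] v] by simp
    from not_invertible_poly_op_root[OF sym nz this]
    obtain r where r: "r \<in> op_spectrum A" "(norm (poly_op p A))\<^sup>2 = (poly p r)\<^sup>2"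
      by (auto simp: power2_eq_square)
    then have "\<bar>poly p r\<bar> = norm (poly_op p A)"
      by (metis abs_norm_cancel real_sqrt_abs)
    with r show ?thesis by blast
  qed
  show ?thesis
  proof (cases "[:(norm (poly_op p A))\<^sup>2:] - p * p = 0")
    case True
    \<comment> \<open>In this degenerate case \<open>p^2\<close> is constant and any spectral point
      will do. One exists by the other case applied to \<open>p = x\<close>, for which
      \<open>N^2 - x^2\<close> is never the zero polynomial.\<close>
    have "op_spectrum A \<noteq> {}"
      using *[of "[:0, 1:]"] by auto
    then obtain r where r: "r \<in> op_spectrum A" by blast
    have "poly ([:(norm (poly_op p A))\<^sup>2:] - p * p) r = 0" using True by simp
    then have "(norm (poly_op p A))\<^sup>2 = (poly p r)\<^sup>2"
      by (simp add: power2_eq_square)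
    then have "\<bar>poly p r\<bar> = norm (poly_op p A)"
      by (metis abs_norm_cancel real_sqrt_abs)
    with r show ?thesis by blast
  qed (rule *)
qed

lemma norm_poly_op_le:
  fixes A :: "'a::{real_inner, banach} \<Rightarrow>\<^sub>L 'a"
  assumes "symmetric_op A" "c \<ge> 0" "\<And>r. r \<in> op_spectrum A \<Longrightarrow> \<bar>poly p r\<bar> \<le> c"
  shows "norm (poly_op p A) \<le> c"
proof (cases "\<exists>v::'a. v \<noteq> 0")
  case True
  then show ?thesis using norm_poly_op_attained[OF assms(1)] assms(3) by metis
next
  case False
  then have "poly_op p A = 0" by (intro blinfun_eqI) metis
  with assms(2) show ?thesis by simp
qed

section \<open>Functional calculus and resolvents\<close>

text \<open>The common route to the three parameter derivatives below (resolvent form, functional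
  calculus, integral of \<open>\<xi>\<close>): a second order error bound passes through norms and
  integrals.\<close>

lemma DERIV_quadratic_remainder:
  fixes f :: "real \<Rightarrow> real"
  assumes "d > 0" and bd: "\<And>w. \<bar>w - t\<bar> < d \<Longrightarrow> \<bar>f w - f t - D * (w - t)\<bar> \<le> K * (w - t)\<^sup>2"
  shows "(f has_real_derivative D) (at t)"
proof -
  have "((\<lambda>h::real. (f (t + h) - f t) / h - D) \<longlongrightarrow> 0) (at 0)"
  proof (rule Lim_null_comparison)
    show "eventually (\<lambda>h::real. norm ((f (t + h) - f t) / h - D) \<le> K * \<bar>h\<bar>) (at 0)"
      unfolding eventually_at
    proof (intro exI[of _ d] conjI ballI impI)
      fix h :: real assume h: "h \<noteq> 0 \<and> dist h 0 < d"
      then have "\<bar>f (t + h) - f t - D * h\<bar> \<le> K * h\<^sup>2" using bd[of "t + h"] by simp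
      then have "\<bar>f (t + h) - f t - D * h\<bar> / \<bar>h\<bar> \<le> K * h\<^sup>2 / \<bar>h\<bar>" by (rule divide_right_mono) simp
      moreover have "\<bar>f (t + h) - f t - D * h\<bar> / \<bar>h\<bar> = \<bar>(f (t + h) - f t) / h - D\<bar>"
        using h by (simp add: abs_divide[symmetric] diff_divide_distrib)
      moreover have "K * h\<^sup>2 / \<bar>h\<bar> = K * \<bar>h\<bar>"
        using h by (simp add: power2_eq_square abs_if)
      ultimately show "norm ((f (t + h) - f t) / h - D) \<le> K * \<bar>h\<bar>" by simp
    qed (use \<open>d > 0\<close> in auto)
    have "((\<lambda>h. K * \<bar>h\<bar>) \<longlongrightarrow> K * \<bar>0\<bar>) (at (0::real))"
      by (intro tendsto_intros)
    then show "((\<lambda>h. K * \<bar>h\<bar>) \<longlongrightarrow> 0) (at (0::real))" by simp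
  qed
  then show ?thesis by (simp add: DERIV_def LIM_zero_iff)
qed

text \<open>The relation under the description operator in \<open>fun_calc\<close>, named so that
  its algebra can be developed before existence and uniqueness are known.\<close>

definition calc_limit ::
    "(real \<Rightarrow> real) \<Rightarrow> ('a::real_normed_vector \<Rightarrow>\<^sub>L 'a) \<Rightarrow> ('a \<Rightarrow>\<^sub>L 'a) \<Rightarrow> bool" where
  "calc_limit \<phi> A T \<longleftrightarrow> (\<exists>p. uniform_limit (op_spectrum A) (\<lambda>n. poly (p n)) \<phi> sequentially \<and>
                           (\<lambda>n. poly_op (p n) A) \<longlonglongrightarrow> T)"

lemma calc_limit_poly: "calc_limit (poly p) A (poly_op p A)"
  unfolding calc_limit_def by (intro exI[of _ "\<lambda>_. p"]) (auto intro: uniform_limit_const)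

lemma poly_ext_diff: "poly (p - q) = (\<lambda>x. poly p x - poly q x)"
  and poly_ext_mult: "poly (p * q) = (\<lambda>x. poly p x * poly q x)"
  for p q :: "'a::comm_ring poly"
  by auto

lemma calc_limit_cong:
  assumes "calc_limit \<phi> A T" "\<And>x. x \<in> op_spectrum A \<Longrightarrow> \<phi> x = \<psi> x"
  shows "calc_limit \<psi> A T"
  using assms unfolding calc_limit_def by (metis (no_types, lifting) uniform_limit_cong')

lemma calc_limit_diff:
  assumes "calc_limit \<phi> A S" "calc_limit \<psi> A T"
  shows "calc_limit (\<lambda>x. \<phi> x - \<psi> x) A (S - T)"
proof -
  obtain p q where
    "uniform_limit (op_spectrum A) (\<lambda>n. poly (p n)) \<phi> sequentially" "(\<lambda>n. poly_op (p n) A) \<longlonglongrightarrow> S"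
    "uniform_limit (op_spectrum A) (\<lambda>n. poly (q n)) \<psi> sequentially" "(\<lambda>n. poly_op (q n) A) \<longlonglongrightarrow> T"
    using assms unfolding calc_limit_def by blast
  note lim = this
  have "uniform_limit (op_spectrum A) (\<lambda>n x. poly (p n) x - poly (q n) x) (\<lambda>x. \<phi> x - \<psi> x) sequentially"
    by (intro uniform_limit_minus lim)
  moreover have "(\<lambda>n. poly_op (p n) A - poly_op (q n) A) \<longlonglongrightarrow> S - T"
    by (intro tendsto_diff lim)
  ultimately show ?thesis unfolding calc_limit_def
    by (intro exI[of _ "\<lambda>n. p n - q n"]) (simp add: poly_op_diff poly_ext_diff)
qed

lemma calc_limit_poly_mult:
  assumes "calc_limit \<phi> A T" "bounded (op_spectrum A)" "bounded (\<phi> ` op_spectrum A)"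
  shows "calc_limit (\<lambda>x. poly q x * \<phi> x) A (poly_op q A o\<^sub>L T)"
proof -
  obtain p where p: "uniform_limit (op_spectrum A) (\<lambda>n. poly (p n)) \<phi> sequentially"
    "(\<lambda>n. poly_op (p n) A) \<longlonglongrightarrow> T"
    using assms unfolding calc_limit_def by blast
  have "continuous_on (closure (op_spectrum A)) (poly q)"
    by (intro continuous_intros)
  then have "bounded (poly q ` closure (op_spectrum A))"
    using assms(2) by (intro compact_imp_bounded compact_continuous_image) auto
  then have "bounded (poly q ` op_spectrum A)"
    by (rule bounded_subset) (intro image_mono closure_subset)
  then have "uniform_limit (op_spectrum A) (\<lambda>n x. poly q x * poly (p n) x) (\<lambda>x. poly q x * \<phi> x) sequentially"
    by (intro uniform_lim_mult uniform_limit_const p assms(3))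
  moreover have "(\<lambda>n. poly_op q A o\<^sub>L poly_op (p n) A) \<longlonglongrightarrow> (poly_op q A o\<^sub>L T)"
    by (intro bounded_bilinear.tendsto[OF bounded_bilinear_blinfun_compose] tendsto_const p)
  ultimately show ?thesis unfolding calc_limit_def
    by (intro exI[of _ "\<lambda>n. q * p n"]) (simp add: poly_op_mult poly_ext_mult)
qed

context
  fixes A :: "'a::{real_inner, banach} \<Rightarrow>\<^sub>L 'a"
  assumes sym: "symmetric_op A"
begin

text \<open>A polynomial within \<open>e\<close> of the function on the spectrum is bounded there by
  \<open>c + e\<close>, and norms pass to the limit. For a difference and \<open>c = 0\<close> this
  is the uniqueness that \<open>fun_calc\<close> needs.\<close>

lemma calc_limit_norm_le:
  assumes T: "calc_limit \<phi> A T" and c: "c \<ge> 0" "\<And>x. x \<in> op_spectrum A \<Longrightarrow> \<bar>\<phi> x\<bar> \<le> c"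
  shows "norm T \<le> c"
proof (rule field_le_epsilon)
  fix e :: real assume e: "e > 0"
  obtain p where p: "uniform_limit (op_spectrum A) (\<lambda>n. poly (p n)) \<phi> sequentially"
    "(\<lambda>n. poly_op (p n) A) \<longlonglongrightarrow> T"
    using T unfolding calc_limit_def by blast
  have "eventually (\<lambda>n. norm (poly_op (p n) A) \<le> c + e) sequentially"
    using uniform_limitD[OF p(1) e]
  proof eventually_elim
    case (elim n)
    show ?case
    proof (rule norm_poly_op_le[OF sym])
      fix x assume x: "x \<in> op_spectrum A"
      show "\<bar>poly (p n) x\<bar> \<le> c + e"
        using bspec[OF elim x] c(2)[OF x] unfolding dist_real_def by linarith
    qed (use c e in simp)
  qed
  then show "norm T \<le> c + e"
    by (rule tendsto_upperbound[OF tendsto_norm[OF p(2)]]) simp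
qed

lemma calc_limit_unique:
  assumes "calc_limit \<phi> A S" "calc_limit \<phi> A T"
  shows "S = T"
  using calc_limit_norm_le[OF calc_limit_diff[OF assms], of 0] by simp

lemma fun_calc_eq: "calc_limit \<phi> A T \<Longrightarrow> fun_calc \<phi> A = T"
  unfolding fun_calc_def calc_limit_def[symmetric]
  by (rule the_equality) (auto intro: calc_limit_unique)

text \<open>Weierstrass approximation on the interval; \<open>norm_poly_op_le\<close> turns uniform
  closeness of the polynomials on the spectrum into a Cauchy sequence of operators.\<close>

lemma calc_limit_exists:
  assumes spec: "op_spectrum A \<subseteq> {a..b}" and cont: "continuous_on {a..b} \<phi>"
  shows "\<exists>T. calc_limit \<phi> A T"
proof -
  have "\<exists>p. \<forall>x\<in>{a..b}. \<bar>\<phi> x - poly p x\<bar> < e" if e: "e > 0" for e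
  proof -
    obtain g where g: "real_polynomial_function g" "\<And>x. x \<in> {a..b} \<Longrightarrow> \<bar>\<phi> x - g x\<bar> < e"
      using Stone_Weierstrass_real_polynomial_function[OF compact_Icc cont e] by blast
    obtain c n where "g = (\<lambda>x. \<Sum>i\<le>n. c i * x ^ i)"
      using g(1) unfolding real_polynomial_function_iff_sum by blast
    then have "poly (\<Sum>i\<le>n. monom (c i) i) x = g x" for x
      by (simp add: poly_sum poly_monom)
    with g show ?thesis by (intro exI[of _ "\<Sum>i\<le>n. monom (c i) i"]) simp
  qed
  then have "\<forall>n. \<exists>p. \<forall>x\<in>{a..b}. \<bar>\<phi> x - poly p x\<bar> < 1 / real (Suc n)" by simp
  then obtain p where p: "\<And>n x. x \<in> {a..b} \<Longrightarrow> \<bar>\<phi> x - poly (p n) x\<bar> < 1 / real (Suc n)"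
    by metis
  have inv: "\<exists>N. \<forall>n\<ge>N. 1 / real (Suc n) < e" if "e > 0" for e :: real
  proof -
    obtain N where "1 / real (Suc N) < e" using nat_approx_posE[OF \<open>e > 0\<close>] by blast
    moreover have "1 / real (Suc n) \<le> 1 / real (Suc N)" if "n \<ge> N" for n
      using that by (simp add: frac_le)
    ultimately show ?thesis by (meson le_less_trans)
  qed
  have ul: "uniform_limit (op_spectrum A) (\<lambda>n. poly (p n)) \<phi> sequentially"
  proof (rule uniform_limitI)
    fix e :: real assume "e > 0"
    then obtain N where "\<forall>n\<ge>N. 1 / real (Suc n) < e" using inv by blast
    then show "\<forall>\<^sub>F n in sequentially. \<forall>x\<in>op_spectrum A. dist (poly (p n) x) (\<phi> x) < e"
      unfolding eventually_sequentially dist_real_def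
      using p spec by (metis abs_minus_commute less_trans subsetD)
  qed
  have "Cauchy (\<lambda>n. poly_op (p n) A)"
  proof (rule CauchyI)
    fix e :: real assume e: "e > 0"
    then obtain N where N: "\<And>n. n \<ge> N \<Longrightarrow> 1 / real (Suc n) < e / 3" using inv[of "e / 3"] by auto
    have le: "norm (poly_op (p m) A - poly_op (p n) A) \<le> 2 * e / 3" if mn: "m \<ge> N" "n \<ge> N" for m n
      unfolding poly_op_diff[symmetric]
    proof (rule norm_poly_op_le[OF sym])
      fix r assume "r \<in> op_spectrum A"
      then have "r \<in> {a..b}" using spec by blast
      from p[OF this, of m] p[OF this, of n] N[OF mn(1)] N[OF mn(2)]
      show "\<bar>poly (p m - p n) r\<bar> \<le> 2 * e / 3" unfolding poly_diff by linarith
    qed (use e in simp)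
    have "norm (poly_op (p m) A - poly_op (p n) A) < e" if "m \<ge> N" "n \<ge> N" for m n
      using le[OF that] e by linarith
    then show "\<exists>M. \<forall>m\<ge>M. \<forall>n\<ge>M. norm (poly_op (p m) A - poly_op (p n) A) < e"
      by blast
  qed
  then obtain T where "(\<lambda>n. poly_op (p n) A) \<longlonglongrightarrow> T"
    using Cauchy_convergent_iff convergent_def by blast
  with ul show ?thesis unfolding calc_limit_def by blast
qed

text \<open>Continuity provides some value \<open>T\<close> of the calculus; multiplicativity turns
  \<open>q \<phi> = 1\<close> into \<open>poly_op q A o\<^sub>L T = id_blinfun\<close>, and a left
  inverse must coincide with this right inverse.\<close>

lemma calc_limit_inverse:
  assumes spec: "op_spectrum A \<subseteq> {a..b}" and cont: "continuous_on {a..b} \<phi>"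
    and inv: "\<And>x. x \<in> {a..b} \<Longrightarrow> poly q x * \<phi> x = 1" and R: "R o\<^sub>L poly_op q A = id_blinfun"
  shows "calc_limit \<phi> A R"
proof -
  obtain T where T: "calc_limit \<phi> A T" using calc_limit_exists[OF spec cont] by blast
  have "bounded (\<phi> ` op_spectrum A)"
    using compact_imp_bounded[OF compact_continuous_image[OF cont compact_Icc]] spec
    by (meson bounded_subset image_mono)
  then have "calc_limit (\<lambda>x. poly q x * \<phi> x) A (poly_op q A o\<^sub>L T)"
    using bounded_subset[OF bounded_closed_interval spec] by (intro calc_limit_poly_mult T)
  then have "calc_limit (poly 1) A (poly_op q A o\<^sub>L T)"
    by (rule calc_limit_cong) (use inv spec in auto)
  then have "poly_op q A o\<^sub>L T = poly_op 1 A"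
    by (rule calc_limit_unique[OF _ calc_limit_poly])
  then have "poly_op q A o\<^sub>L T = id_blinfun"
    by (simp add: poly_op_const[of 1] one_pCons)
  then have "R o\<^sub>L (poly_op q A o\<^sub>L T) = R" by simp
  then have "T = R" by (simp add: blinfun_compose_assoc[symmetric] R)
  with T show ?thesis by simp
qed

end

section \<open>Resolvents of positive operators\<close>

definition resolvent :: "real \<Rightarrow> ('a::real_normed_vector \<Rightarrow>\<^sub>L 'a) \<Rightarrow> ('a \<Rightarrow>\<^sub>L 'a)" where
  "resolvent z A = (SOME R. R o\<^sub>L (A + z *\<^sub>R id_blinfun) = id_blinfun \<and>
                            (A + z *\<^sub>R id_blinfun) o\<^sub>L R = id_blinfun \<and> norm R \<le> 1 / z)"

locale positive_op =
  fixes A :: "'a::{real_inner, banach} \<Rightarrow>\<^sub>L 'a"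
  assumes sym: "symmetric_op A" and pos: "inner (A x) x \<ge> 0"
begin

lemma spectrum_subset: "op_spectrum A \<subseteq> {0..norm A}"
  using op_spectrum_positive_subset pos by blast

text \<open>The spectral parameter is \<open>- z\<close>, so for \<open>z > 0\<close> the operator
  \<open>A + z\<close> is coercive with constant \<open>z\<close>; this justifies the choice in
  \<open>resolvent\<close>.\<close>

lemma resolvent_props:
  assumes "z > 0"
  shows "resolvent z A o\<^sub>L (A + z *\<^sub>R id_blinfun) = id_blinfun \<and>
    (A + z *\<^sub>R id_blinfun) o\<^sub>L resolvent z A = id_blinfun \<and> norm (resolvent z A) \<le> 1 / z"
  unfolding resolvent_def
proof (rule someI_ex)
  have "z * (norm x)\<^sup>2 \<le> inner ((A + z *\<^sub>R id_blinfun) x) x" for x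
    using pos[of x] by (simp add: blinfun.add_left blinfun.scaleR_left inner_simps power2_norm_eq_inner)
  from coercive_inverse[OF assms this]
  show "\<exists>R. R o\<^sub>L (A + z *\<^sub>R id_blinfun) = id_blinfun \<and>
      (A + z *\<^sub>R id_blinfun) o\<^sub>L R = id_blinfun \<and> norm R \<le> 1 / z" by metis
qed

lemma resolvent_cancel:
  assumes "z > 0"
  shows "resolvent z A (A x + z *\<^sub>R x) = x"
    and "A (resolvent z A x) + z *\<^sub>R resolvent z A x = x"
proof -
  have "(resolvent z A o\<^sub>L (A + z *\<^sub>R id_blinfun)) x = id_blinfun x"
    and "((A + z *\<^sub>R id_blinfun) o\<^sub>L resolvent z A) x = id_blinfun x"
    using resolvent_props[OF assms] by simp_all
  then show "resolvent z A (A x + z *\<^sub>R x) = x"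
    and "A (resolvent z A x) + z *\<^sub>R resolvent z A x = x"
    by (simp_all add: blinfun.add_left blinfun.scaleR_left)
qed

lemma norm_resolvent_le: "z > 0 \<Longrightarrow> norm (resolvent z A x) \<le> norm x / z"
  using norm_blinfun[of "resolvent z A" x] mult_right_mono[of "norm (resolvent z A)" "1 / z" "norm x"]
    resolvent_props[of z] by simp

lemma inner_resolvent:
  assumes "z > 0"
  shows "inner (resolvent z A x) y = inner x (resolvent z A y)"
proof -
  let ?u = "resolvent z A x" and ?v = "resolvent z A y"
  have "inner ?u (A ?v + z *\<^sub>R ?v) = inner (A ?u + z *\<^sub>R ?u) ?v"
    using symmetric_opD[OF sym, of ?u ?v] by (simp add: inner_simps)
  then show ?thesis by (simp add: resolvent_cancel[OF assms])
qed

lemma inner_resolvent_nonneg: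
  assumes "z > 0"
  shows "inner (resolvent z A x) x \<ge> 0"
proof -
  let ?u = "resolvent z A x"
  have "inner ?u (A ?u + z *\<^sub>R ?u) \<ge> 0"
    using pos[of ?u] assms by (simp add: inner_simps inner_commute)
  then show ?thesis by (simp add: resolvent_cancel[OF assms])
qed

lemma resolvent_identity:
  assumes "w > 0" "z > 0"
  shows "resolvent w A x - resolvent z A x = (z - w) *\<^sub>R resolvent w A (resolvent z A x)"
proof -
  let ?v = "resolvent z A x"
  have "x = (A ?v + w *\<^sub>R ?v) + (z - w) *\<^sub>R ?v"
    using resolvent_cancel(2)[OF assms(2), of x] by (simp add: algebra_simps)
  then have "resolvent w A x = resolvent w A (A ?v + w *\<^sub>R ?v) + (z - w) *\<^sub>R resolvent w A ?v"
    by (metis blinfun.add_right blinfun.scaleR_right)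
  then show ?thesis using resolvent_cancel(1)[OF assms(1), of ?v] by simp
qed

text \<open>Using the resolvent identity twice gives the remainder exactly, as
  \<open>(w - z)^2\<close> times the inner product of \<open>R z x\<close> with
  \<open>R w (R z x)\<close>, where \<open>R\<close> is the resolvent; it stays bounded while
  \<open>w > z / 2\<close>.\<close>

lemma DERIV_inner_resolvent:
  assumes z: "z > 0"
  shows "((\<lambda>z. inner (resolvent z A x) x) has_real_derivative - (norm (resolvent z A x))\<^sup>2) (at z)"
proof (rule DERIV_quadratic_remainder)
  let ?R = "\<lambda>z. resolvent z A"
  show "0 < z / 2" using z by simp
  fix w assume "\<bar>w - z\<bar> < z / 2"
  then have w: "w > z / 2" "w > 0" by linarith+
  have "inner (?R w x) x - inner (?R z x) x = (z - w) * inner (?R z x) (?R w x)"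
    unfolding inner_diff_left[symmetric] resolvent_identity[OF w(2) z]
    by (simp add: inner_resolvent[OF w(2)])
  also have "\<dots> = (z - w) * inner (?R z x) (?R z x + (z - w) *\<^sub>R ?R w (?R z x))"
    using resolvent_identity[OF w(2) z, of x] by (metis add.commute diff_add_cancel)
  finally have "inner (?R w x) x - inner (?R z x) x - (- (norm (?R z x))\<^sup>2) * (w - z)
      = (w - z)\<^sup>2 * inner (?R z x) (?R w (?R z x))"
    unfolding power2_norm_eq_inner by (simp add: inner_simps power2_eq_square algebra_simps)
  moreover have "\<bar>inner (?R z x) (?R w (?R z x))\<bar> \<le> norm (?R z x) * (norm (?R z x) / (z / 2))"
  proof -
    have "norm (?R w (?R z x)) \<le> norm (?R z x) / w" by (rule norm_resolvent_le[OF w(2)])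
    also have "\<dots> \<le> norm (?R z x) / (z / 2)" using w z by (intro divide_left_mono) auto
    finally show ?thesis
      by (rule order_trans[OF Cauchy_Schwarz_ineq2 mult_left_mono]) simp
  qed
  then have "(w - z)\<^sup>2 * \<bar>inner (?R z x) (?R w (?R z x))\<bar>
      \<le> (w - z)\<^sup>2 * (norm (?R z x) * (norm (?R z x) / (z / 2)))"
    by (rule mult_left_mono) simp
  ultimately show "\<bar>inner (?R w x) x - inner (?R z x) x - (- (norm (?R z x))\<^sup>2) * (w - z)\<bar>
      \<le> norm (?R z x) * (norm (?R z x) / (z / 2)) * (w - z)\<^sup>2"
    by (simp only: abs_mult abs_power2 mult.commute)
qed

lemma calc_limit_resolvent:
  assumes z: "z > 0" and \<phi>: "\<And>x. 0 \<le> x \<Longrightarrow> x \<le> norm A \<Longrightarrow> \<phi> x = 1 / (x + z)"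
  shows "calc_limit \<phi> A (resolvent z A)"
proof (rule calc_limit_inverse[OF sym spectrum_subset])
  have "continuous_on {0..norm A} (\<lambda>x. 1 / (x + z))"
    using z by (intro continuous_intros) auto
  then show "continuous_on {0..norm A} \<phi>"
    by (rule continuous_on_eq) (simp add: \<phi>)
  show "poly [:z, 1:] x * \<phi> x = 1" if "x \<in> {0..norm A}" for x
    using that z by (simp add: \<phi> add.commute)
  show "resolvent z A o\<^sub>L poly_op [:z, 1:] A = id_blinfun"
    using resolvent_props[OF z] by (simp add: poly_op_linear)
qed

end

section \<open>The primitive \<open>s arctan (t / s)\<close> and its operator form\<close>

lemma arctan_le_self: "0 \<le> x \<Longrightarrow> arctan x \<le> (x::real)"
proof -
  assume x: "0 \<le> x"
  have "0 - arctan 0 \<le> x - arctan x"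
  proof (rule DERIV_nonneg_imp_nondecreasing[OF x])
    fix u :: real
    have "((\<lambda>u. u - arctan u) has_real_derivative 1 - inverse (1 + u\<^sup>2)) (at u)"
      by (auto intro!: derivative_eq_intros)
    moreover have "0 \<le> 1 - inverse (1 + u\<^sup>2)"
      by (simp add: inverse_le_1_iff)
    ultimately show "\<exists>y. ((\<lambda>u. u - arctan u) has_real_derivative y) (at u) \<and> 0 \<le> y" by blast
  qed
  then show ?thesis by simp
qed

text \<open>At \<open>s = 0\<close> the convention \<open>t / 0 = 0\<close> makes both sides vanish,
  so 0 in the spectrum needs no separate treatment later.\<close>

lemma DERIV_mult_arctan:
  fixes s t :: real
  assumes "t > 0"
  shows "((\<lambda>t. s * arctan (t / s)) has_real_derivative s\<^sup>2 / (s\<^sup>2 + t\<^sup>2)) (at t)"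
proof (cases "s = 0")
  case False
  have "1 + (t / s)\<^sup>2 = (s\<^sup>2 + t\<^sup>2) / s\<^sup>2"
    using False by (simp add: field_simps)
  with False show ?thesis
    by (auto intro!: derivative_eq_intros simp: field_simps power2_eq_square)
qed simp

text \<open>What matters is that the bound is uniform in \<open>s\<close>: it can then be read as a
  bound in operator norm through \<open>calc_limit_norm_le\<close>.\<close>

lemma arctan_remainder:
  fixes s t w :: real
  assumes t: "t > 0" and w: "\<bar>w - t\<bar> < t / 2"
  shows "\<bar>s * arctan (w / s) - s * arctan (t / s) - (w - t) * (s\<^sup>2 / (s\<^sup>2 + t\<^sup>2))\<bar>
    \<le> 3 / t * (w - t)\<^sup>2"
proof (cases "w = t")
  case False
  let ?h = "\<lambda>t. s * arctan (t / s)" and ?f = "\<lambda>t. s\<^sup>2 / (s\<^sup>2 + t\<^sup>2)"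
  have "\<exists>u. \<bar>u - t\<bar> \<le> \<bar>w - t\<bar> \<and> ?h w - ?h t = (w - t) * ?f u"
  proof (cases "w < t")
    case True
    have "\<exists>u>w. u < t \<and> ?h t - ?h w = (t - w) * ?f u"
      by (rule MVT2[OF True]) (use DERIV_mult_arctan w t in auto)
    then obtain u where u: "w < u" "u < t" "?h t - ?h w = (t - w) * ?f u" by blast
    have "?h w - ?h t = (w - t) * ?f u"
      using u(3) by (metis minus_diff_eq mult_minus_left)
    then show ?thesis using u(1,2) by (intro exI[of _ u] conjI) linarith+
  next
    case False
    then have "t < w" using \<open>w \<noteq> t\<close> by simp
    then have "\<exists>u>t. u < w \<and> ?h w - ?h t = (w - t) * ?f u"
      by (rule MVT2) (use DERIV_mult_arctan t in auto)
    then obtain u where "t < u" "u < w" "?h w - ?h t = (w - t) * ?f u" by blast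
    then show ?thesis by (intro exI[of _ u] conjI) linarith+
  qed
  then obtain u where u: "\<bar>u - t\<bar> \<le> \<bar>w - t\<bar>" "?h w - ?h t = (w - t) * ?f u" by blast
  \<comment> \<open>The mean value point satisfies \<open>u < 3 / 2 * t\<close>, so
    \<open>u + t \<le> 3 * t\<close> with room to spare; this is the origin of the constant
    3.\<close>
  have up: "u > 0" "u + t \<le> 3 * t" using u w t by linarith+
  have pos: "s\<^sup>2 + u\<^sup>2 > 0" "s\<^sup>2 + t\<^sup>2 > 0" using up t by (simp_all add: add_nonneg_pos)
  have "?f u - ?f t = (s\<^sup>2 / (s\<^sup>2 + u\<^sup>2)) * (((t - u) * (u + t)) / (s\<^sup>2 + t\<^sup>2))"
  proof -
    have "s\<^sup>2 + u\<^sup>2 \<noteq> 0" "s\<^sup>2 + t\<^sup>2 \<noteq> 0" using pos by auto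
    then have "?f u - ?f t = (s\<^sup>2 * (s\<^sup>2 + t\<^sup>2) - s\<^sup>2 * (s\<^sup>2 + u\<^sup>2)) / ((s\<^sup>2 + u\<^sup>2) * (s\<^sup>2 + t\<^sup>2))"
      by (rule diff_frac_eq)
    also have "s\<^sup>2 * (s\<^sup>2 + t\<^sup>2) - s\<^sup>2 * (s\<^sup>2 + u\<^sup>2) = s\<^sup>2 * ((t - u) * (u + t))"
      by (simp add: algebra_simps power2_eq_square)
    finally show ?thesis by simp
  qed
  then have "\<bar>?f u - ?f t\<bar> = \<bar>s\<^sup>2 / (s\<^sup>2 + u\<^sup>2)\<bar> * \<bar>((t - u) * (u + t)) / (s\<^sup>2 + t\<^sup>2)\<bar>"
    by (simp only: abs_mult)
  also have "\<dots> \<le> 1 * (\<bar>w - t\<bar> * (3 * t) / t\<^sup>2)"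
  proof (intro mult_mono)
    show "\<bar>s\<^sup>2 / (s\<^sup>2 + u\<^sup>2)\<bar> \<le> 1" using pos by simp
    have "\<bar>(t - u) * (u + t)\<bar> \<le> \<bar>w - t\<bar> * (3 * t)"
      unfolding abs_mult using u up t by (intro mult_mono) auto
    then show "\<bar>((t - u) * (u + t)) / (s\<^sup>2 + t\<^sup>2)\<bar> \<le> \<bar>w - t\<bar> * (3 * t) / t\<^sup>2"
      unfolding abs_divide using t pos by (intro frac_le) auto
  qed auto
  also have "\<dots> = 3 / t * \<bar>w - t\<bar>"
    using t by (simp add: power2_eq_square)
  finally have "\<bar>w - t\<bar> * \<bar>?f u - ?f t\<bar> \<le> \<bar>w - t\<bar> * (3 / t * \<bar>w - t\<bar>)"
    by (rule mult_left_mono) simp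
  moreover have "?h w - ?h t - (w - t) * ?f t = (w - t) * (?f u - ?f t)"
    unfolding u(2) by (simp add: right_diff_distrib)
  ultimately show ?thesis
    by (simp only: abs_mult) (simp add: power2_eq_square mult_ac)
qed simp

lemma symmetric_op_compose_self:
  "symmetric_op A \<Longrightarrow> symmetric_op (A o\<^sub>L A)"
  by (simp add: symmetric_op_def)

lemma positive_op_square:
  fixes A :: "'a::{real_inner, banach} \<Rightarrow>\<^sub>L 'a"
  assumes "symmetric_op A"
  shows "positive_op (A o\<^sub>L A)"
proof
  show "inner ((A o\<^sub>L A) x) x \<ge> 0" for x
    using symmetric_opD[OF assms, of "A x" x] by simp
qed (rule symmetric_op_compose_self[OF assms])

context positive_op
begin

lemma resolvent_square_commute:
  assumes z: "z > 0"
  shows "resolvent z (A o\<^sub>L A) (A x) = A (resolvent z (A o\<^sub>L A) x)"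
proof -
  interpret S: positive_op "A o\<^sub>L A" by (rule positive_op_square[OF sym])
  let ?R = "resolvent z (A o\<^sub>L A)"
  have "A x = (A o\<^sub>L A) (A (?R x)) + z *\<^sub>R A (?R x)"
    using S.resolvent_cancel(2)[OF z, of x]
    by (metis blinfun.add_right blinfun.scaleR_right blinfun_apply_blinfun_compose)
  then show ?thesis using S.resolvent_cancel(1)[OF z, of "A (?R x)"] by metis
qed

text \<open>The spectral-theorem identity \<open>2/\<pi> \<integral> s\<^sup>2 / (s\<^sup>2 + t\<^sup>2) dt = s\<close> under the form of \<open>A\<close>: the primitive
  \<open>s arctan (t / s)\<close> is differentiated in operator norm through the functional calculus.\<close>

lemma integral_resolvent_square:
  shows "set_integrable lborel {0<..} (\<lambda>t. inner (resolvent (t\<^sup>2) (A o\<^sub>L A) (A x)) (A x))"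
    and "(LINT t:{0<..}|lborel. inner (resolvent (t\<^sup>2) (A o\<^sub>L A) (A x)) (A x)) = pi / 2 * inner (A x) x"
proof -
  interpret S: positive_op "A o\<^sub>L A" by (rule positive_op_square[OF sym])
  let ?M = "norm A"
  define h where "h = (\<lambda>t s::real. s * arctan (t / s))"
  define f where "f = (\<lambda>t. inner (resolvent (t\<^sup>2) (A o\<^sub>L A) (A x)) (A x))"
  have h_le: "0 \<le> h t s" "h t s \<le> t" if "0 \<le> s" "t \<ge> 0" for t s
    using that arctan_le_self[of "t / s"] by (cases "s = 0"; auto simp: h_def field_simps)+
  have h_cont: "continuous_on {0..?M} (h t)" for t
  proof (rule continuous_at_imp_continuous_on, rule ballI)
    fix s :: real
    show "isCont (h t) s"
    proof (cases "s = 0")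
      case False
      then show ?thesis unfolding h_def by (intro continuous_intros) auto
    next
      case True
      have "(h t \<longlongrightarrow> 0) (at 0)"
      proof (rule Lim_null_comparison[OF always_eventually])
        show "\<forall>s. norm (h t s) \<le> pi / 2 * \<bar>s\<bar>"
        proof
          fix s
          have "\<bar>arctan (t / s)\<bar> \<le> pi / 2" using arctan_bounded[of "t / s"] by linarith
          from mult_left_mono[OF this abs_ge_zero[of s]]
          show "norm (h t s) \<le> pi / 2 * \<bar>s\<bar>"
            unfolding h_def real_norm_def abs_mult by (simp only: mult.commute)
        qed
        have "((\<lambda>s. pi / 2 * \<bar>s\<bar>) \<longlongrightarrow> pi / 2 * \<bar>0\<bar>) (at (0::real))" by (intro tendsto_intros)
        then show "((\<lambda>s. pi / 2 * \<bar>s\<bar>) \<longlongrightarrow> 0) (at (0::real))" by simp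
      qed
      then show ?thesis using True by (simp add: isCont_def h_def)
    qed
  qed
  define H where "H = (\<lambda>t. SOME T. calc_limit (h t) A T)"
  have H: "calc_limit (h t) A (H t)" for t
    unfolding H_def by (rule someI_ex) (rule calc_limit_exists[OF sym spectrum_subset h_cont])
  have F: "calc_limit (\<lambda>s. s\<^sup>2 / (s\<^sup>2 + t\<^sup>2)) A ((A o\<^sub>L A) o\<^sub>L resolvent (t\<^sup>2) (A o\<^sub>L A))" if "t > 0" for t
  proof -
    let ?R = "resolvent (t\<^sup>2) (A o\<^sub>L A)" and ?g = "\<lambda>s::real. 1 / (s\<^sup>2 + t\<^sup>2)"
    have nz: "s\<^sup>2 + t\<^sup>2 \<noteq> 0" for s using that by (simp add: sum_power2_eq_zero_iff)
    have gc: "continuous_on {0..?M} ?g" by (intro continuous_intros) (use nz in auto)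
    have pA: "poly_op [:0, 0, 1:] A = A o\<^sub>L A" "poly_op [:t\<^sup>2, 0, 1:] A = (A o\<^sub>L A) + t\<^sup>2 *\<^sub>R id_blinfun"
      by (simp_all add: poly_op_pCons blinfun_compose_bilinear)
    have "calc_limit ?g A ?R"
      by (rule calc_limit_inverse[OF sym spectrum_subset gc, where q = "[:t\<^sup>2, 0, 1:]"])
         (use nz S.resolvent_props[of "t\<^sup>2"] that in \<open>auto simp: pA power2_eq_square[symmetric] add.commute\<close>)
    moreover have "bounded (?g ` op_spectrum A)"
      using compact_imp_bounded[OF compact_continuous_image[OF gc compact_Icc]] spectrum_subset
      by (meson bounded_subset image_mono)
    ultimately have "calc_limit (\<lambda>s. poly [:0, 0, 1:] s * ?g s) A (poly_op [:0, 0, 1:] A o\<^sub>L ?R)"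
      using bounded_subset[OF bounded_closed_interval spectrum_subset] by (intro calc_limit_poly_mult)
    then show ?thesis by (simp add: pA power2_eq_square)
  qed
  have f_eq: "inner (((A o\<^sub>L A) o\<^sub>L resolvent (t\<^sup>2) (A o\<^sub>L A)) x) x = f t" if "t > 0" for t
    using that by (simp add: f_def resolvent_square_commute symmetric_opD[OF sym])
  have inner_le: "\<bar>inner (T x) x\<bar> \<le> c * (norm x)\<^sup>2" if "norm T \<le> c" for T :: "'a \<Rightarrow>\<^sub>L 'a" and c
    using Cauchy_Schwarz_ineq2[of "T x" x] mult_right_mono[OF norm_blinfun[of T x], of "norm x"]
      mult_right_mono[OF that, of "(norm x)\<^sup>2"]
    by (simp add: power2_eq_square mult_ac)
  have deriv: "((\<lambda>t. inner (H t x) x) has_real_derivative f t) (at t)" if t: "t > 0" for t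
  proof (rule DERIV_quadratic_remainder)
    show "0 < t / 2" using t by simp
    fix w assume w: "\<bar>w - t\<bar> < t / 2"
    let ?F = "(A o\<^sub>L A) o\<^sub>L resolvent (t\<^sup>2) (A o\<^sub>L A)"
    \<comment> \<open>The scalar first order expansion of \<open>h\<close> in \<open>t\<close> is
      lifted to operators as a whole, so that one norm bound controls its remainder.\<close>
    have "calc_limit (\<lambda>s. h w s - h t s - poly [:w - t:] s * (s\<^sup>2 / (s\<^sup>2 + t\<^sup>2))) A
        (H w - H t - (poly_op [:w - t:] A o\<^sub>L ?F))"
    proof (intro calc_limit_diff H calc_limit_poly_mult F t)
      show "bounded (op_spectrum A)" by (rule bounded_subset[OF bounded_closed_interval spectrum_subset])
      have "\<bar>s\<^sup>2 / (s\<^sup>2 + t\<^sup>2)\<bar> \<le> 1" for s :: real using t by (simp add: add_nonneg_pos)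
      then show "bounded ((\<lambda>s. s\<^sup>2 / (s\<^sup>2 + t\<^sup>2)) ` op_spectrum A)" unfolding bounded_iff by auto
    qed
    then have "norm (H w - H t - (poly_op [:w - t:] A o\<^sub>L ?F)) \<le> 3 / t * (w - t)\<^sup>2"
      by (rule calc_limit_norm_le[OF sym]) (use arctan_remainder[OF t w] t in \<open>auto simp: h_def\<close>)
    from inner_le[OF this]
    show "\<bar>inner (H w x) x - inner (H t x) x - f t * (w - t)\<bar> \<le> (3 / t * (norm x)\<^sup>2) * (w - t)\<^sup>2"
      using f_eq[OF t]
      by (simp add: poly_op_const blinfun.diff_left blinfun.scaleR_left inner_simps mult_ac)
  qed
  have f_nonneg: "f t \<ge> 0" if "t > 0" for t
    unfolding f_def by (rule S.inner_resolvent_nonneg) (use that in simp)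
  have f_cont: "isCont f t" if "t > 0" for t
  proof -
    have "((\<lambda>t. inner (resolvent (t\<^sup>2) (A o\<^sub>L A) (A x)) (A x)) has_real_derivative
        - (norm (resolvent (t\<^sup>2) (A o\<^sub>L A) (A x)))\<^sup>2 * (2 * t)) (at t)"
      by (rule DERIV_chain2[OF S.DERIV_inner_resolvent]) (use that in \<open>auto intro!: derivative_eq_intros\<close>)
    then show ?thesis unfolding f_def by (rule DERIV_isCont)
  qed
  \<comment> \<open>Since \<open>arctan u \<le> u\<close> for nonnegative \<open>u\<close>, the
    function \<open>h t\<close> is at most \<open>t\<close> on the spectrum, hence
    \<open>norm (H t) \<le> t\<close>.\<close>
  have lim0: "((\<lambda>t. inner (H t x) x) \<longlongrightarrow> 0) (at_right 0)"
  proof (rule Lim_null_comparison)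
    show "eventually (\<lambda>t. norm (inner (H t x) x) \<le> t * (norm x)\<^sup>2) (at_right 0)"
      unfolding eventually_at_right_field
    proof (intro exI[of _ 1] conjI allI impI)
      fix t :: real assume t: "0 < t"
      have "norm (H t) \<le> t"
      proof (rule calc_limit_norm_le[OF sym H])
        fix s assume "s \<in> op_spectrum A"
        then have "0 \<le> s" using spectrum_subset by auto
        with h_le[of s t] t show "\<bar>h t s\<bar> \<le> t" by simp
      qed (use t in simp)
      then show "norm (inner (H t x) x) \<le> t * (norm x)\<^sup>2" using inner_le by simp
    qed simp
    have "((\<lambda>t. t * (norm x)\<^sup>2) \<longlongrightarrow> 0 * (norm x)\<^sup>2) (at_right 0)" by (intro tendsto_intros)
    then show "((\<lambda>t. t * (norm x)\<^sup>2) \<longlongrightarrow> 0) (at_right 0)" by simp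
  qed
  have limoo: "((\<lambda>t. inner (H t x) x) \<longlongrightarrow> pi / 2 * inner (A x) x) at_top"
  proof (rule LIM_zero_cancel, rule Lim_null_comparison)
    show "eventually (\<lambda>t. norm (inner (H t x) x - pi / 2 * inner (A x) x) \<le> ?M\<^sup>2 * (norm x)\<^sup>2 / t) at_top"
      using eventually_gt_at_top[of 0]
    proof eventually_elim
      fix t :: real assume t: "0 < t"
      have "norm (H t - poly_op [:0, pi / 2:] A) \<le> ?M\<^sup>2 / t"
      proof (rule calc_limit_norm_le[OF sym calc_limit_diff[OF H calc_limit_poly]])
        fix s assume "s \<in> op_spectrum A"
        then have s: "0 \<le> s" "s \<le> ?M" using spectrum_subset by auto
        show "\<bar>h t s - poly [:0, pi / 2:] s\<bar> \<le> ?M\<^sup>2 / t"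
        proof (cases "s = 0")
          case False
          \<comment> \<open>The reflection formula exhibits the distance of \<open>h t s\<close>
            from \<open>pi / 2 * s\<close> as \<open>s arctan (s / t)\<close>, which is at most
            \<open>s^2 / t\<close>.\<close>
          then have arc: "arctan (t / s) = pi / 2 - arctan (s / t)"
            using arctan_inverse[of "s / t"] s t by simp
          have "h t s - poly [:0, pi / 2:] s = - (s * arctan (s / t))"
            unfolding h_def arc by (simp add: right_diff_distrib)
          moreover have "0 \<le> s * arctan (s / t)" using s t by simp
          moreover have "s * arctan (s / t) \<le> s * (s / t)"
            using s t by (intro mult_left_mono arctan_le_self) auto
          moreover have "s * (s / t) \<le> ?M\<^sup>2 / t"
            using s t by (auto simp: power2_eq_square intro!: divide_right_mono mult_mono)
          ultimately show ?thesis by linarith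
        qed (use t in \<open>simp add: h_def\<close>)
      qed (use t in simp)
      from inner_le[OF this]
      show "norm (inner (H t x) x - pi / 2 * inner (A x) x) \<le> ?M\<^sup>2 * (norm x)\<^sup>2 / t"
        by (simp add: poly_op_pCons blinfun_compose_bilinear blinfun.diff_left blinfun.scaleR_left
            inner_simps)
    qed
    show "((\<lambda>t. ?M\<^sup>2 * (norm x)\<^sup>2 / t) \<longlongrightarrow> 0) at_top"
      by (intro tendsto_divide_0[OF tendsto_const] filterlim_at_top_imp_at_infinity filterlim_ident)
  qed
  \<comment> \<open>The integrand is nonnegative and the primitive has finite limits at both ends,
    so this form of the fundamental theorem gives integrability along with the value.\<close>
  have ivl: "einterval 0 \<infinity> = {0<..}"
    by (auto simp: einterval_def)
  have k1: "(0::ereal) < \<infinity>" by simp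
  have k2: "DERIV (\<lambda>t. inner (H t x) x) t :> f t" if "0 < ereal t" "ereal t < \<infinity>" for t
    using deriv that by simp
  have k3: "isCont f t" if "0 < ereal t" "ereal t < \<infinity>" for t
    using f_cont that by simp
  have k4: "AE t in lborel. 0 < ereal t \<longrightarrow> ereal t < \<infinity> \<longrightarrow> 0 \<le> f t"
    using f_nonneg by simp
  have k5: "(((\<lambda>t. inner (H t x) x) \<circ> real_of_ereal) \<longlongrightarrow> 0) (at_right 0)"
    using lim0 by (simp only: ereal_tendsto_simps1 zero_ereal_def)
  have k6: "(((\<lambda>t. inner (H t x) x) \<circ> real_of_ereal) \<longlongrightarrow> pi / 2 * inner (A x) x) (at_left \<infinity>)"
    using limoo by (simp only: ereal_tendsto_simps1)
  note interval_integral_FTC_nonneg[OF k1 k2 k3 k4 k5 k6]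
  then show "set_integrable lborel {0<..} (\<lambda>t. inner (resolvent (t\<^sup>2) (A o\<^sub>L A) (A x)) (A x))"
    and "(LINT t:{0<..}|lborel. inner (resolvent (t\<^sup>2) (A o\<^sub>L A) (A x)) (A x)) = pi / 2 * inner (A x) x"
    by (simp_all add: interval_lebesgue_integral_def ivl f_def)
qed

end

section \<open>Hankel operators on the sequence space\<close>

instance ell2 :: banach ..

lemma positive_form_inner_nonneg: "positive_form T \<Longrightarrow> inner (T x) x \<ge> 0"
  unfolding positive_form_def inner_ell2_eq_Re_cinner by (simp add: complex_nonneg_Reals_iff)

text \<open>Only real scalars act on \<open>ell2\<close>, so complex multiples of basis vectors need
  their own constructor.\<close>

lift_definition ell2_single :: "nat \<Rightarrow> complex \<Rightarrow> ell2" is "\<lambda>m c n. if n = m then c else 0"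
  unfolding sq_summable_def by (rule summable_finite[of "{_}"]) auto

lemma inner_ell2_single: "inner (ell2_single m c) y = inner c (ell2_nth y m)"
proof -
  have "inner (ell2_nth (ell2_single m c) n) (ell2_nth y n)
      = (if n = m then inner c (ell2_nth y n) else 0)" for n
    by (simp add: ell2_single.rep_eq)
  then show ?thesis
    unfolding inner_ell2_def using sums_unique[OF sums_single, of "\<lambda>n. inner c (ell2_nth y n)" m]
    by simp
qed

lemma ell2_basis_eq_single: "ell2_basis n = ell2_single n 1"
  by (rule ell2_eqI) (simp add: ell2_nth_basis ell2_single.rep_eq)

lemma inner_ell2_basis: "inner x (ell2_basis n) = Re (ell2_nth x n)"
  using inner_ell2_single[of n 1 x] by (simp add: ell2_basis_eq_single inner_commute[of x] inner_complex_def)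

lemma cinner_ell2_basis: "cinner x (ell2_basis n) = ell2_nth x n"
proof -
  have "ell2_nth x m * cnj (ell2_nth (ell2_basis n) m) = (if m = n then ell2_nth x m else 0)" for m
    by (simp add: ell2_nth_basis)
  then show ?thesis
    unfolding cinner_def using sums_unique[OF sums_single, of "ell2_nth x" n] by simp
qed

lemma ell2_nth_sum: "ell2_nth (sum f A) n = (\<Sum>i\<in>A. ell2_nth (f i) n)"
  by (induction A rule: infinite_finite_induct) (auto simp: zero_ell2.rep_eq plus_ell2.rep_eq)

lemma ell2_single_sums: "(\<lambda>m. ell2_single m (ell2_nth x m)) sums x"
proof -
  let ?S = "\<lambda>N. \<Sum>m<N. ell2_single m (ell2_nth x m)" and ?f = "\<lambda>n. (norm (ell2_nth x n))\<^sup>2"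
  have nth: "ell2_nth (?S N - x) n = (if n < N then 0 else - ell2_nth x n)" for N n
    by (simp add: minus_ell2.rep_eq ell2_nth_sum ell2_single.rep_eq)
  have "(norm (?S N - x))\<^sup>2 = (\<Sum>n. ?f n) - (\<Sum>n<N. ?f n)" for N
  proof -
    have "(norm (?S N - x))\<^sup>2 = (\<Sum>n. ?f (n + N))"
      unfolding norm_ell2_sq using suminf_split_initial_segment[OF summable_ell2[of "?S N - x"], of N]
      by (simp add: nth)
    then show ?thesis by (simp add: suminf_minus_initial_segment[OF summable_ell2])
  qed
  moreover have "(\<lambda>N. (\<Sum>n. ?f n) - (\<Sum>n<N. ?f n)) \<longlonglongrightarrow> (\<Sum>n. ?f n) - (\<Sum>n. ?f n)"
    by (intro tendsto_diff tendsto_const summable_LIMSEQ summable_ell2)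
  ultimately have "(\<lambda>N. (norm (?S N - x))\<^sup>2) \<longlonglongrightarrow> 0" by simp
  then have "(\<lambda>N. norm (?S N - x)) \<longlonglongrightarrow> 0"
    using tendsto_real_sqrt by fastforce
  then show ?thesis
    unfolding sums_def by (simp add: tendsto_norm_zero_iff LIM_zero_iff)
qed

text \<open>Its fixed points are the vectors with real coordinates.\<close>

lift_definition ell2_cnj :: "ell2 \<Rightarrow> ell2" is "\<lambda>x n. cnj (x n)"
  by (simp add: sq_summable_def)

lemma ell2_cnj_add: "ell2_cnj (x + y) = ell2_cnj x + ell2_cnj y"
  by (rule ell2_eqI) (simp add: ell2_cnj.rep_eq plus_ell2.rep_eq)

lemma ell2_cnj_scaleR: "ell2_cnj (c *\<^sub>R x) = c *\<^sub>R ell2_cnj x"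
  by (rule ell2_eqI) (simp add: ell2_cnj.rep_eq scaleR_ell2.rep_eq)

lemma ell2_cnj_basis: "ell2_cnj (ell2_basis n) = ell2_basis n"
  by (rule ell2_eqI) (simp add: ell2_cnj.rep_eq ell2_nth_basis)

lemma ell2_nth_of_real:
  assumes "ell2_cnj x = x"
  shows "ell2_nth x n = complex_of_real (Re (ell2_nth x n))"
  using arg_cong[OF assms, of "\<lambda>x. ell2_nth x n"] by (simp add: ell2_cnj.rep_eq complex_eq_iff)

section \<open>Symmetry, reality and the rank one identity for Hankel operators\<close>

context
  fixes \<alpha> :: "nat \<Rightarrow> real"
  assumes \<alpha>: "\<alpha> \<in> ell1_weak"
begin

lemma hankel_row_summable_complex: "summable (\<lambda>m. complex_of_real (\<alpha> (n + m)) * ell2_nth x m)"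
  by (rule summable_norm_cancel) (rule hankel_row_summable[OF \<alpha>])

lemma hankel_single: "ell2_nth (hankel \<alpha> (ell2_single m c)) n = complex_of_real (\<alpha> (n + m)) * c"
proof -
  have "complex_of_real (\<alpha> (n + k)) * ell2_nth (ell2_single m c) k
      = (if k = m then complex_of_real (\<alpha> (n + k)) * c else 0)" for k
    by (simp add: ell2_single.rep_eq)
  then show ?thesis
    unfolding ell2_nth_hankel[OF \<alpha>]
    using sums_unique[OF sums_single, of "\<lambda>k. complex_of_real (\<alpha> (n + k)) * c" m] by simp
qed

text \<open>For vectors with a single nonzero coordinate this is the symmetry of
  \<open>\<alpha> (n + m)\<close> in \<open>n\<close> and \<open>m\<close>; continuity extends it
  along the expansion of \<open>x\<close>, which avoids interchanging a double sum.\<close>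

lemma symmetric_op_hankel: "symmetric_op (hankel \<alpha>)"
  unfolding symmetric_op_def
proof (intro allI)
  fix x y
  have single: "inner (hankel \<alpha> (ell2_single m c)) y = inner c (ell2_nth (hankel \<alpha> y) m)" for m c
  proof -
    have *: "inner (complex_of_real r * c) w = inner c (complex_of_real r * w)" for r w
      by (simp add: inner_complex_def algebra_simps)
    have "inner (hankel \<alpha> (ell2_single m c)) y
        = (\<Sum>n. inner c (complex_of_real (\<alpha> (m + n)) * ell2_nth y n))"
      unfolding inner_ell2_def hankel_single * by (simp add: add.commute)
    also have "\<dots> = inner c (\<Sum>n. complex_of_real (\<alpha> (m + n)) * ell2_nth y n)"
      by (rule bounded_linear.suminf[OF bounded_linear_inner_right hankel_row_summable_complex, symmetric])
    finally show ?thesis by (simp add: ell2_nth_hankel[OF \<alpha>])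
  qed
  have "(\<lambda>m. hankel \<alpha> (ell2_single m (ell2_nth x m))) sums hankel \<alpha> x"
    by (rule bounded_linear.sums[OF blinfun.bounded_linear_right ell2_single_sums])
  then have "(\<lambda>m. inner (hankel \<alpha> (ell2_single m (ell2_nth x m))) y) sums inner (hankel \<alpha> x) y"
    by (rule bounded_linear.sums[OF bounded_linear_inner_left])
  then show "inner (hankel \<alpha> x) y = inner x (hankel \<alpha> y)"
    unfolding single inner_ell2_def[of x] by (rule sums_unique)
qed

lemma hankel_cnj: "hankel \<alpha> (ell2_cnj x) = ell2_cnj (hankel \<alpha> x)"
proof (rule ell2_eqI)
  fix n
  show "ell2_nth (hankel \<alpha> (ell2_cnj x)) n = ell2_nth (ell2_cnj (hankel \<alpha> x)) n"
    using bounded_linear.suminf[OF bounded_linear_cnj hankel_row_summable_complex[of n x]]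
    by (simp add: ell2_nth_hankel[OF \<alpha>] ell2_cnj.rep_eq)
qed

lemma hankel_basis_0: "ell2_nth (hankel \<alpha> (ell2_basis 0)) n = complex_of_real (\<alpha> n)"
  by (simp add: ell2_basis_eq_single hankel_single)

text \<open>The vector \<open>hankel (shift \<alpha>) x\<close> is \<open>hankel \<alpha> x\<close>
  without its first coordinate. Applying the shifted matrix to it gives the row sums of
  \<open>hankel \<alpha>\<close> without the term \<open>m = 0\<close>, and that term is the rank
  one part.\<close>

lemma hankel_square_eq:
  "ell2_nth (hankel \<alpha> (hankel \<alpha> x)) n
     = ell2_nth (hankel (shift \<alpha>) (hankel (shift \<alpha>) x)) n
       + complex_of_real (\<alpha> n) * ell2_nth (hankel \<alpha> x) 0"
proof -
  note S = ell2_nth_hankel[OF shift_ell1_weak[OF \<alpha>]]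
  let ?y = "hankel \<alpha> x"
  have "ell2_nth (hankel (shift \<alpha>) x) m = ell2_nth ?y (Suc m)" for m
    unfolding S ell2_nth_hankel[OF \<alpha>] by (simp add: shift_def)
  then have "ell2_nth (hankel (shift \<alpha>) (hankel (shift \<alpha>) x)) n
      = (\<Sum>m. complex_of_real (\<alpha> (n + Suc m)) * ell2_nth ?y (Suc m))"
    unfolding S by (simp add: shift_def)
  also have "\<dots> = ell2_nth (hankel \<alpha> ?y) n - complex_of_real (\<alpha> (n + 0)) * ell2_nth ?y 0"
    unfolding ell2_nth_hankel[OF \<alpha>, of ?y n]
    by (rule suminf_split_head[OF hankel_row_summable_complex])
  finally show ?thesis by simp
qed

text \<open>The coefficient is the coordinate of \<open>hankel \<alpha> x\<close> at 0. The real
  inner product sees only its real part, which is all of it when \<open>x\<close> is real.\<close>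

lemma hankel_square_rank_one:
  assumes "ell2_cnj x = x"
  defines "a \<equiv> hankel \<alpha> (ell2_basis 0)"
  shows "hankel \<alpha> (hankel \<alpha> x) = hankel (shift \<alpha>) (hankel (shift \<alpha>) x) + inner x a *\<^sub>R a"
proof (rule ell2_eqI)
  fix n
  have "ell2_cnj (hankel \<alpha> x) = hankel \<alpha> x" by (simp add: hankel_cnj[symmetric] assms)
  then have "ell2_nth (hankel \<alpha> x) 0 = complex_of_real (inner (hankel \<alpha> x) (ell2_basis 0))"
    using ell2_nth_of_real by (simp add: inner_ell2_basis)
  then have "ell2_nth (hankel \<alpha> x) 0 = complex_of_real (inner x a)"
    by (simp add: a_def symmetric_opD[OF symmetric_op_hankel])
  then show "ell2_nth (hankel \<alpha> (hankel \<alpha> x)) n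
      = ell2_nth (hankel (shift \<alpha>) (hankel (shift \<alpha>) x) + inner x a *\<^sub>R a) n"
    unfolding hankel_square_eq plus_ell2.rep_eq scaleR_ell2.rep_eq
    by (simp add: a_def hankel_basis_0 scaleR_conv_of_real)
qed

lemma positive_op_hankel_square: "positive_op (hankel \<alpha> o\<^sub>L hankel \<alpha>)"
  by (rule positive_op_square[OF symmetric_op_hankel])

text \<open>Conjugating the resolvent equation yields the same equation, whose solution is
  unique.\<close>

lemma resolvent_hankel_cnj:
  assumes "z > 0" "ell2_cnj x = x"
  shows "ell2_cnj (resolvent z (hankel \<alpha> o\<^sub>L hankel \<alpha>) x) = resolvent z (hankel \<alpha> o\<^sub>L hankel \<alpha>) x"
proof -
  interpret B: positive_op "hankel \<alpha> o\<^sub>L hankel \<alpha>" by (rule positive_op_hankel_square)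
  let ?u = "resolvent z (hankel \<alpha> o\<^sub>L hankel \<alpha>) x"
  have "(hankel \<alpha> o\<^sub>L hankel \<alpha>) (ell2_cnj ?u) + z *\<^sub>R ell2_cnj ?u
      = ell2_cnj ((hankel \<alpha> o\<^sub>L hankel \<alpha>) ?u + z *\<^sub>R ?u)"
    by (simp add: hankel_cnj ell2_cnj_add ell2_cnj_scaleR)
  also have "\<dots> = x" by (simp only: B.resolvent_cancel(2)[OF assms(1)] assms(2))
  finally show ?thesis using B.resolvent_cancel(1)[OF assms(1), of "ell2_cnj ?u"] by metis
qed

end

text \<open>The Sherman-Morrison formula: \<open>(A + z) v = D a\<close> with
  \<open>D = 1 - inner v a\<close>, so the resolvent of \<open>A\<close> maps \<open>a\<close> to
  \<open>v / D\<close>. On real vectors the two resolvents then differ by \<open>- (1 / D)\<close>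
  times the rank one form of \<open>v\<close>, whose trace is read off on the basis.\<close>

lemma
  fixes \<alpha> :: "nat \<Rightarrow> real"
  assumes \<alpha>: "\<alpha> \<in> ell1_weak" and z: "z > 0"
  defines "a \<equiv> hankel \<alpha> (ell2_basis 0)"
    and "B \<equiv> hankel \<alpha> o\<^sub>L hankel \<alpha>" and "A \<equiv> hankel (shift \<alpha>) o\<^sub>L hankel (shift \<alpha>)"
  defines "v \<equiv> resolvent z B a"
  shows perturbation_determinant_pos: "1 - inner v a > 0"
    and op_trace_resolvent_diff:
      "op_trace (resolvent z B - resolvent z A) = complex_of_real (- ((norm v)\<^sup>2 / (1 - inner v a)))"
proof -
  interpret B: positive_op B unfolding B_def by (rule positive_op_hankel_square[OF \<alpha>])
  interpret A: positive_op A unfolding A_def by (rule positive_op_hankel_square[OF shift_ell1_weak[OF \<alpha>]])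
  let ?D = "1 - inner v a"
  have a_real: "ell2_cnj a = a"
    unfolding a_def by (simp add: hankel_cnj[OF \<alpha>, symmetric] ell2_cnj_basis)
  have res_real: "ell2_cnj (resolvent z B x) = resolvent z B x" if "ell2_cnj x = x" for x
    unfolding B_def by (rule resolvent_hankel_cnj[OF \<alpha> z that])
  have res: "A (resolvent z B x) + z *\<^sub>R resolvent z B x = x - inner (resolvent z B x) a *\<^sub>R a"
    if "ell2_cnj x = x" for x
    using hankel_square_rank_one[OF \<alpha> res_real[OF that]] B.resolvent_cancel(2)[OF z, of x]
    unfolding A_def B_def a_def by (simp add: algebra_simps)
  have v: "A v + z *\<^sub>R v = ?D *\<^sub>R a"
    using res[OF a_real] by (simp add: v_def algebra_simps)
  show D: "?D > 0"
  proof (cases "v = 0")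
    case False
    \<comment> \<open>Pairing \<open>(A + z) v = D a\<close> with \<open>v\<close> shows that
      \<open>D * inner v a\<close> is positive. Both factors cannot be negative, because
      \<open>inner v a < 0\<close> forces \<open>D > 1\<close>.\<close>
    have "z * (norm v)\<^sup>2 \<le> inner (A v + z *\<^sub>R v) v"
      using A.pos[of v] by (simp add: inner_simps power2_norm_eq_inner)
    moreover have "inner (A v + z *\<^sub>R v) v = ?D * inner v a"
      unfolding v by (simp add: inner_commute)
    moreover have "z * (norm v)\<^sup>2 > 0" using z False by simp
    ultimately have "?D * inner v a > 0" by linarith
    then show ?thesis by (auto simp: zero_less_mult_iff)
  qed simp
  have Qa: "resolvent z A a = (1 / ?D) *\<^sub>R v"
  proof -
    have "v = ?D *\<^sub>R resolvent z A a"
      using A.resolvent_cancel(1)[OF z, of v] by (simp only: v blinfun.scaleR_right)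
    then show ?thesis using D by (metis divide_self_if less_irrefl scaleR_one scaleR_scaleR times_divide_eq_left mult_1)
  qed
  \<comment> \<open>The coefficient \<open>inner ?w a\<close> is the \<open>n\<close>-th coordinate
    of \<open>v\<close> by symmetry of the resolvent, so the diagonal entries sum to a multiple of
    \<open>\<parallel>v\<parallel>^2\<close>.\<close>
  have diag: "cinner ((resolvent z B - resolvent z A) (ell2_basis n)) (ell2_basis n)
      = complex_of_real (- (1 / ?D) * (norm (ell2_nth v n))\<^sup>2)" for n
  proof -
    let ?e = "ell2_basis n" and ?w = "resolvent z B (ell2_basis n)"
    have "?w = resolvent z A (?e - inner ?w a *\<^sub>R a)"
      using A.resolvent_cancel(1)[OF z, of ?w] res[OF ell2_cnj_basis, of n] by simp
    also have "\<dots> = resolvent z A ?e - inner ?w a *\<^sub>R ((1 / ?D) *\<^sub>R v)"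
      by (simp only: blinfun.diff_right blinfun.scaleR_right Qa)
    finally have "(resolvent z B - resolvent z A) ?e = (- (inner ?w a / ?D)) *\<^sub>R v"
      by (simp add: blinfun.diff_left algebra_simps)
    moreover have "inner ?w a = Re (ell2_nth v n)"
      unfolding B.inner_resolvent[OF z] v_def[symmetric] inner_commute[of ?e] by (rule inner_ell2_basis)
    moreover have "ell2_nth v n = complex_of_real (Re (ell2_nth v n))"
      using ell2_nth_of_real[OF res_real[OF a_real]] by (simp add: v_def)
    then obtain r where "ell2_nth v n = complex_of_real r" by blast
    ultimately show ?thesis
      by (simp add: cinner_ell2_basis uminus_ell2.rep_eq scaleR_ell2.rep_eq scaleR_conv_of_real power2_eq_square)
  qed
  have "(\<lambda>n. complex_of_real (- (1 / ?D) * (norm (ell2_nth v n))\<^sup>2))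
      sums complex_of_real (- (1 / ?D) * (norm v)\<^sup>2)"
    unfolding norm_ell2_sq by (intro sums_of_real sums_mult summable_sums summable_ell2)
  from sums_unique[OF this]
  show "op_trace (resolvent z B - resolvent z A) = complex_of_real (- ((norm v)\<^sup>2 / ?D))"
    unfolding op_trace_def diag by simp
qed

section \<open>The perturbation determinant\<close>

lemma integrable_mult_bounded:
  fixes f g :: "'a \<Rightarrow> real"
  assumes "integrable M f" "g \<in> borel_measurable M" "\<And>x. \<bar>g x\<bar> \<le> K"
  shows "integrable M (\<lambda>x. f x * g x)"
proof (rule Bochner_Integration.integrable_bound)
  show "integrable M (\<lambda>x. K * f x)" using assms(1) by simp
  show "AE x in M. norm (f x * g x) \<le> norm (K * f x)"
  proof (rule AE_I2)
    fix x
    have "\<bar>g x\<bar> * \<bar>f x\<bar> \<le> \<bar>K\<bar> * \<bar>f x\<bar>"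
      using assms(3)[of x] by (intro mult_right_mono) auto
    then show "norm (f x * g x) \<le> norm (K * f x)" by (simp add: abs_mult mult.commute)
  qed
  show "(\<lambda>x. f x * g x) \<in> borel_measurable M"
    by (intro borel_measurable_times borel_measurable_integrable assms)
qed

lemma abs_integral_mult_le:
  fixes f g :: "'a \<Rightarrow> real"
  assumes f: "integrable M f" and g: "g \<in> borel_measurable M" "\<And>x. \<bar>g x\<bar> \<le> K"
  shows "\<bar>LINT x|M. f x * g x\<bar> \<le> K * (LINT x|M. \<bar>f x\<bar>)"
proof -
  note fg = integrable_mult_bounded[OF assms]
  have "\<bar>LINT x|M. f x * g x\<bar> \<le> (LINT x|M. \<bar>f x * g x\<bar>)"
    by (rule integral_abs_bound)
  also have "\<dots> \<le> (LINT x|M. K * \<bar>f x\<bar>)"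
  proof (rule integral_mono)
    show "\<bar>f x * g x\<bar> \<le> K * \<bar>f x\<bar>" for x
      unfolding abs_mult using mult_right_mono[OF g(2), of "\<bar>f x\<bar>" x] by (simp add: mult.commute)
  qed (intro integrable_abs integrable_mult_right fg f)+
  finally show ?thesis by simp
qed

lemma integral_linear_combination:
  fixes f g h :: "'a \<Rightarrow> real"
  assumes "integrable M f" "integrable M g" "integrable M h"
  shows "(LINT x|M. f x - g x + c * h x) = (LINT x|M. f x) - (LINT x|M. g x) + c * (LINT x|M. h x)"
  by (simp only: assms Bochner_Integration.integral_add Bochner_Integration.integral_diff
      Bochner_Integration.integrable_diff integrable_mult_right integral_mult_right_zero)

lemma borel_measurable_lebesgue_of_lborel:
  "f \<in> borel_measurable borel \<Longrightarrow> f \<in> borel_measurable lebesgue"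
  by (rule measurable_completion) (simp only: measurable_lborel2)

section \<open>The determinant expressed through the spectral shift function\<close>

locale hankel_ssf =
  fixes \<alpha> :: "nat \<Rightarrow> real" and \<xi> :: "real \<Rightarrow> real"
  assumes \<alpha>: "\<alpha> \<in> ell1_weak" and ssf: "is_hankel_ssf \<xi> \<alpha>"
begin

abbreviation "B \<equiv> hankel \<alpha> o\<^sub>L hankel \<alpha>"
abbreviation "A \<equiv> hankel (shift \<alpha>) o\<^sub>L hankel (shift \<alpha>)"
abbreviation "a \<equiv> hankel \<alpha> (ell2_basis 0)"

text \<open>\<open>pert_det z\<close> is the perturbation determinant of \<open>A\<close> with respect to \<open>B\<close> at \<open>- z\<close>, and
  \<open>log_det z\<close> turns out to be minus its logarithm.\<close>

definition pert_det :: "real \<Rightarrow> real" where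
  "pert_det z = 1 - inner (resolvent z B a) a"

definition log_det :: "real \<Rightarrow> real" where
  "log_det z = (LINT l:{0..}|lebesgue. \<xi> l / (l + z))"

lemma \<xi>_integrable: "integrable lebesgue \<xi>"
  using ssf by (simp add: is_hankel_ssf_def is_spectral_shift_def)

lemma trace_formula:
  assumes "test_function \<phi>"
  shows "op_trace (fun_calc \<phi> B - fun_calc \<phi> A) = complex_of_real (LINT l|lebesgue. \<xi> l * deriv \<phi> l)"
  using ssf assms by (simp add: is_hankel_ssf_def is_spectral_shift_def)

lemma set_integral_eq: "(LINT l:{0..}|lebesgue. \<xi> l / g l) = (LINT l|lebesgue. \<xi> l * (indicator {0..} l / g l))"
  unfolding set_lebesgue_integral_def by (rule Bochner_Integration.integral_cong) auto

sublocale B: positive_op B by (rule positive_op_hankel_square[OF \<alpha>])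
sublocale A: positive_op A by (rule positive_op_hankel_square[OF shift_ell1_weak[OF \<alpha>]])

text \<open>Once \<open>n\<close> exceeds both operator norms, the test function equals
  \<open>1 / (x + z)\<close> on both spectra and the trace no longer changes with \<open>n\<close>;
  only the integral side passes to a limit.\<close>

lemma integral_inverse_square:
  assumes z: "z > 0"
  shows "(LINT l:{0..}|lebesgue. \<xi> l / (l + z)\<^sup>2) = (norm (resolvent z B a))\<^sup>2 / pert_det z"
proof -
  obtain \<phi> K where test: "\<And>n. test_function (\<phi> n)" and el: "\<And>n. elementary (\<phi> n)"
    and val: "\<And>n x. 0 \<le> x \<Longrightarrow> x \<le> real n \<Longrightarrow> \<phi> n x = 1 / (x + z)"
    and K: "\<And>n x. \<bar>deriv (\<phi> n) x\<bar> \<le> K"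
    and lim_pos: "\<And>x. x > 0 \<Longrightarrow> (\<lambda>n. deriv (\<phi> n) x) \<longlonglongrightarrow> - (1 / (x + z)\<^sup>2)"
    and lim_neg: "\<And>x. x < 0 \<Longrightarrow> (\<lambda>n. deriv (\<phi> n) x) \<longlonglongrightarrow> 0"
    using resolvent_test_functions[OF z] by metis
  let ?g = "\<lambda>l::real. - (indicator {0..} l / (l + z)\<^sup>2)"
  have meas: "deriv (\<phi> n) \<in> borel_measurable lebesgue" for n
    by (intro borel_measurable_lebesgue_of_lborel borel_measurable_continuous_onI
        continuous_at_imp_continuous_on ballI elementary_isCont elementary_deriv el)
  have "(\<lambda>n. LINT l|lebesgue. \<xi> l * deriv (\<phi> n) l) \<longlonglongrightarrow> (LINT l|lebesgue. \<xi> l * ?g l)"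
  proof (rule integral_dominated_convergence[where w = "\<lambda>l. K * \<bar>\<xi> l\<bar>"])
    show "(\<lambda>l. \<xi> l * ?g l) \<in> borel_measurable lebesgue"
      by (intro borel_measurable_times borel_measurable_integrable[OF \<xi>_integrable]
          borel_measurable_lebesgue_of_lborel) measurable
    show "(\<lambda>l. \<xi> l * deriv (\<phi> n) l) \<in> borel_measurable lebesgue" for n
      by (intro borel_measurable_times borel_measurable_integrable[OF \<xi>_integrable] meas)
    show "integrable lebesgue (\<lambda>l. K * \<bar>\<xi> l\<bar>)" using \<xi>_integrable by simp
    show "AE l in lebesgue. norm (\<xi> l * deriv (\<phi> n) l) \<le> K * \<bar>\<xi> l\<bar>" for n
    proof (rule AE_I2)
      fix l
      show "norm (\<xi> l * deriv (\<phi> n) l) \<le> K * \<bar>\<xi> l\<bar>"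
        using mult_right_mono[OF K[of n l], of "\<bar>\<xi> l\<bar>"] by (simp add: abs_mult mult.commute)
    qed
    \<comment> \<open>The derivatives of the test functions have a known limit on either side of 0;
      the origin itself is a null set.\<close>
    have "AE l in lebesgue. l \<noteq> (0::real)"
      by (intro AE_completion AE_lborel_singleton)
    then show "AE l in lebesgue. (\<lambda>n. \<xi> l * deriv (\<phi> n) l) \<longlonglongrightarrow> \<xi> l * ?g l"
    proof eventually_elim
      case (elim l)
      have "(\<lambda>n. deriv (\<phi> n) l) \<longlonglongrightarrow> ?g l"
        using lim_pos[of l] lim_neg[of l] elim by (cases "l > 0") auto
      then show ?case by (intro tendsto_intros)
    qed
  qed
  moreover
  obtain N :: nat where N: "max (norm A) (norm B) \<le> real N" using real_arch_simple by blast
  have "(LINT l|lebesgue. \<xi> l * deriv (\<phi> n) l) = - ((norm (resolvent z B a))\<^sup>2 / pert_det z)"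
    if n: "n \<ge> N" for n
  proof -
    have nr: "max (norm A) (norm B) \<le> real n" using N n by (meson of_nat_mono order_trans)
    have "fun_calc (\<phi> n) B = resolvent z B" "fun_calc (\<phi> n) A = resolvent z A"
      by (intro fun_calc_eq[OF B.sym] B.calc_limit_resolvent[OF z] fun_calc_eq[OF A.sym]
          A.calc_limit_resolvent[OF z] val; use nr in simp)+
    then have "complex_of_real (LINT l|lebesgue. \<xi> l * deriv (\<phi> n) l)
        = complex_of_real (- ((norm (resolvent z B a))\<^sup>2 / pert_det z))"
      unfolding trace_formula[OF test, symmetric] pert_det_def
      by (simp only: op_trace_resolvent_diff[OF \<alpha> z])
    then show ?thesis by (simp only: of_real_eq_iff)
  qed
  then have "(\<lambda>n. LINT l|lebesgue. \<xi> l * deriv (\<phi> n) l)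
      \<longlonglongrightarrow> - ((norm (resolvent z B a))\<^sup>2 / pert_det z)"
    by (intro tendsto_eventually) (auto simp: eventually_sequentially)
  ultimately have "(LINT l|lebesgue. \<xi> l * ?g l) = - ((norm (resolvent z B a))\<^sup>2 / pert_det z)"
    by (rule LIMSEQ_unique)
  then show ?thesis by (simp add: set_integral_eq)
qed

lemma kernel_measurable:
  "(\<lambda>l::real. indicator {0..} l / (l + z)) \<in> borel_measurable lebesgue"
  "(\<lambda>l::real. indicator {0..} l / (l + z)\<^sup>2) \<in> borel_measurable lebesgue"
  by (intro borel_measurable_lebesgue_of_lborel; measurable)+

lemma kernel_bound:
  fixes l z :: real
  assumes "z > 0"
  shows "\<bar>indicator {0..} l / (l + z)\<bar> \<le> 1 / z" "\<bar>indicator {0..} l / (l + z)\<^sup>2\<bar> \<le> 1 / z\<^sup>2"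
proof -
  have "\<bar>indicator {0..} l / (l + z)\<bar> \<le> 1 / z \<and> \<bar>indicator {0..} l / (l + z)\<^sup>2\<bar> \<le> 1 / z\<^sup>2"
  proof (cases "0 \<le> l")
    case True
    then have "1 / (l + z) \<le> 1 / z" using assms by (intro frac_le) auto
    moreover have "1 / (l + z)\<^sup>2 \<le> 1 / z\<^sup>2"
      using True assms by (intro frac_le power_mono) auto
    ultimately show ?thesis using True assms by simp
  qed (use assms in simp)
  then show "\<bar>indicator {0..} l / (l + z)\<bar> \<le> 1 / z" "\<bar>indicator {0..} l / (l + z)\<^sup>2\<bar> \<le> 1 / z\<^sup>2"
    by auto
qed

text \<open>For \<open>l \<ge> 0\<close> the second order remainder of the kernel is exactly
  \<open>(w - z)^2 / ((l + w) * (l + z)^2)\<close>, bounded uniformly in \<open>l\<close> when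
  \<open>w > z / 2\<close>; integrating it against \<open>\<xi>\<close> keeps the bound
  quadratic.\<close>

lemma DERIV_log_det:
  assumes z: "z > 0"
  shows "(log_det has_real_derivative - (LINT l:{0..}|lebesgue. \<xi> l / (l + z)\<^sup>2)) (at z)"
proof (rule DERIV_quadratic_remainder)
  show "0 < z / 2" using z by simp
  fix w assume "\<bar>w - z\<bar> < z / 2"
  then have w: "w > z / 2" "w > 0" by linarith+
  let ?k = "\<lambda>l::real. indicator {0..} l / (l + w) - indicator {0..} l / (l + z)
      + (w - z) * (indicator {0..} l / (l + z)\<^sup>2)"
  have arith: "X - Y - (- G) * d = X - Y + d * G" for X Y G d :: real by simp
  note int1 = integrable_mult_bounded[OF \<xi>_integrable kernel_measurable(1) kernel_bound(1)]
    and int2 = integrable_mult_bounded[OF \<xi>_integrable kernel_measurable(2) kernel_bound(2)]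
  have "log_det w - log_det z - (- (LINT l:{0..}|lebesgue. \<xi> l / (l + z)\<^sup>2)) * (w - z)
      = (LINT l|lebesgue. \<xi> l * (indicator {0..} l / (l + w)) - \<xi> l * (indicator {0..} l / (l + z))
          + (w - z) * (\<xi> l * (indicator {0..} l / (l + z)\<^sup>2)))"
    unfolding log_det_def set_integral_eq
      integral_linear_combination[OF int1[OF w(2)] int1[OF z] int2[OF z]]
    by (rule arith)
  also have "\<dots> = (LINT l|lebesgue. \<xi> l * ?k l)"
    by (rule Bochner_Integration.integral_cong) (simp_all add: algebra_simps)
  finally have eq: "log_det w - log_det z - (- (LINT l:{0..}|lebesgue. \<xi> l / (l + z)\<^sup>2)) * (w - z)
      = (LINT l|lebesgue. \<xi> l * ?k l)" .
  have "\<bar>?k l\<bar> \<le> (w - z)\<^sup>2 / (z / 2 * z\<^sup>2)" for l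
  proof (cases "l \<ge> 0")
    case True
    then have pos: "l + w \<noteq> 0" "l + z \<noteq> 0" using w z by linarith+
    then have "?k l = (w - z)\<^sup>2 / ((l + w) * (l + z)\<^sup>2)"
      using True by (simp add: divide_simps) (simp add: algebra_simps power2_eq_square)
    moreover have "z / 2 * z\<^sup>2 \<le> (l + w) * (l + z)\<^sup>2"
      using True w z by (intro mult_mono power_mono) auto
    then have "(w - z)\<^sup>2 / ((l + w) * (l + z)\<^sup>2) \<le> (w - z)\<^sup>2 / (z / 2 * z\<^sup>2)"
      using z True w by (intro divide_left_mono mult_pos_pos) auto
    moreover have "0 \<le> (w - z)\<^sup>2 / ((l + w) * (l + z)\<^sup>2)" using True w by simp
    ultimately show ?thesis by (simp only: abs_of_nonneg)
  qed (use z in simp)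
  moreover have "?k \<in> borel_measurable lebesgue"
    by (intro borel_measurable_lebesgue_of_lborel) measurable
  ultimately have "\<bar>LINT l|lebesgue. \<xi> l * ?k l\<bar> \<le> (w - z)\<^sup>2 / (z / 2 * z\<^sup>2) * (LINT l|lebesgue. \<bar>\<xi> l\<bar>)"
    by (intro abs_integral_mult_le[OF \<xi>_integrable])
  then show "\<bar>log_det w - log_det z - (- (LINT l:{0..}|lebesgue. \<xi> l / (l + z)\<^sup>2)) * (w - z)\<bar>
      \<le> (1 / (z / 2 * z\<^sup>2) * (LINT l|lebesgue. \<bar>\<xi> l\<bar>)) * (w - z)\<^sup>2"
    unfolding eq by (simp add: mult_ac)
qed

lemma pert_det_pos: "z > 0 \<Longrightarrow> pert_det z > 0"
  unfolding pert_det_def by (rule perturbation_determinant_pos[OF \<alpha>])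

lemma const_over_tendsto_0: "((\<lambda>z::real. c / z) \<longlongrightarrow> 0) at_top"
  by (intro tendsto_divide_0[OF tendsto_const] filterlim_at_top_imp_at_infinity filterlim_ident)

lemma pert_det_tendsto: "(pert_det \<longlongrightarrow> 1) at_top"
proof (rule LIM_zero_cancel, rule Lim_null_comparison)
  show "eventually (\<lambda>z. norm (pert_det z - 1) \<le> (norm a)\<^sup>2 / z) at_top"
    using eventually_gt_at_top[of 0]
  proof eventually_elim
    fix z :: real assume z: "0 < z"
    have "\<bar>inner (resolvent z B a) a\<bar> \<le> norm (resolvent z B a) * norm a" by (rule Cauchy_Schwarz_ineq2)
    also have "\<dots> \<le> norm a / z * norm a" by (intro mult_right_mono B.norm_resolvent_le z) simp
    finally show "norm (pert_det z - 1) \<le> (norm a)\<^sup>2 / z"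
      by (simp add: pert_det_def power2_eq_square)
  qed
qed (rule const_over_tendsto_0)

lemma log_det_tendsto: "(log_det \<longlongrightarrow> 0) at_top"
proof (rule Lim_null_comparison)
  show "eventually (\<lambda>z. norm (log_det z) \<le> (LINT l|lebesgue. \<bar>\<xi> l\<bar>) / z) at_top"
    using eventually_gt_at_top[of 0]
  proof eventually_elim
    fix z :: real assume "0 < z"
    from abs_integral_mult_le[OF \<xi>_integrable kernel_measurable(1) kernel_bound(1)[OF this]]
    show "norm (log_det z) \<le> (LINT l|lebesgue. \<bar>\<xi> l\<bar>) / z"
      by (simp add: log_det_def set_integral_eq)
  qed
qed (rule const_over_tendsto_0)

lemma pert_det_eq_exp:
  assumes "z > 0"
  shows "pert_det z = exp (- log_det z)"
proof -
  let ?L = "\<lambda>z. ln (pert_det z) + log_det z"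
  have "(?L has_real_derivative 0) (at z)" if z: "z > 0" for z
  proof -
    have "(pert_det has_real_derivative (norm (resolvent z B a))\<^sup>2) (at z)"
      unfolding pert_det_def[abs_def]
      using DERIV_diff[OF DERIV_const[of 1] B.DERIV_inner_resolvent[OF z, of a]] by simp
    from DERIV_add[OF DERIV_chain2[OF DERIV_ln_divide[OF pert_det_pos[OF z]] this] DERIV_log_det[OF z]]
    show ?thesis by (simp add: integral_inverse_square[OF z])
  qed
  then have "\<forall>z\<in>{0<..}. (?L has_real_derivative 0) (at z within {0<..})"
    by (auto intro: has_field_derivative_at_within)
  then obtain c where c: "\<And>z. z \<in> {0<..} \<Longrightarrow> ?L z = c"
    using has_field_derivative_zero_constant[of "{0<..}" ?L] by auto
  have "(?L \<longlongrightarrow> ln 1 + 0) at_top"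
    by (intro tendsto_intros pert_det_tendsto log_det_tendsto) simp
  moreover have "(?L \<longlongrightarrow> c) at_top"
    by (rule tendsto_eventually, rule eventually_mono[OF eventually_gt_at_top[of 0]]) (simp add: c)
  ultimately have "ln 1 + 0 = c" by (rule tendsto_unique[OF trivial_limit_at_top_linorder])
  then have "c = 0" by simp
  with c[of z] assms have "ln (pert_det z) = - log_det z" by simp
  then show ?thesis using pert_det_pos[OF assms] by (metis exp_ln)
qed

lemma integral_\<xi>: "(LINT l:{0..}|lebesgue. \<xi> l) = (norm a)\<^sup>2"
proof -
  define z where "z = (\<lambda>n. real (Suc n))"
  have z: "z n > 0" for n by (simp add: z_def)
  have z_lim: "filterlim z at_top sequentially"
    unfolding z_def by (rule filterlim_compose[OF filterlim_real_sequentially filterlim_Suc])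
  let ?R = "\<lambda>n. resolvent (z n) B a"
  \<comment> \<open>These kernels are at most 1 and increase to the indicator of the half-line
    pointwise, so \<open>\<bar>\<xi>\<bar>\<close> is a majorant.\<close>
  let ?k = "\<lambda>n l::real. (z n)\<^sup>2 * (indicator {0..} l / (l + z n)\<^sup>2)"
  have "(\<lambda>n. LINT l|lebesgue. \<xi> l * ?k n l) \<longlonglongrightarrow> (LINT l|lebesgue. \<xi> l * indicator {0..} l)"
  proof (rule integral_dominated_convergence[where w = "\<lambda>l. \<bar>\<xi> l\<bar>"])
    show "(\<lambda>l. \<xi> l * indicator {0..} l) \<in> borel_measurable lebesgue"
      by (intro borel_measurable_times borel_measurable_integrable[OF \<xi>_integrable]
          borel_measurable_lebesgue_of_lborel) measurable
    show "(\<lambda>l. \<xi> l * ?k n l) \<in> borel_measurable lebesgue" for n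
      by (intro borel_measurable_times borel_measurable_integrable[OF \<xi>_integrable]
          borel_measurable_const kernel_measurable)
    show "integrable lebesgue (\<lambda>l. \<bar>\<xi> l\<bar>)" using \<xi>_integrable by simp
    show "AE l in lebesgue. norm (\<xi> l * ?k n l) \<le> \<bar>\<xi> l\<bar>" for n
    proof (rule AE_I2)
      fix l
      have "\<bar>?k n l\<bar> \<le> (z n)\<^sup>2 * (1 / (z n)\<^sup>2)"
        using kernel_bound(2)[OF z, of l n] unfolding abs_mult by (intro mult_mono) auto
      also have "\<dots> = 1" using z[of n] by simp
      finally show "norm (\<xi> l * ?k n l) \<le> \<bar>\<xi> l\<bar>"
        unfolding real_norm_def abs_mult[of "\<xi> l"] by (intro mult_left_le) auto
    qed
    show "AE l in lebesgue. (\<lambda>n. \<xi> l * ?k n l) \<longlonglongrightarrow> \<xi> l * indicator {0..} l"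
    proof (rule AE_I2)
      fix l :: real
      have "filterlim (\<lambda>z. l + z) at_top at_top"
        by (rule filterlim_tendsto_add_at_top[OF tendsto_const filterlim_ident])
      then have "((\<lambda>z. 1 - l / (l + z)) \<longlongrightarrow> 1 - 0) at_top"
        by (intro tendsto_diff tendsto_const filterlim_compose[OF const_over_tendsto_0])
      moreover have "eventually (\<lambda>z. 1 - l / (l + z) = z / (l + z)) at_top"
        using eventually_gt_at_top[of "- l"] by eventually_elim (simp add: field_simps)
      ultimately have "((\<lambda>z. z / (l + z)) \<longlongrightarrow> 1) at_top"
        by (simp add: Lim_transform_eventually)
      then have "(\<lambda>n. indicator {0..} l * (z n / (l + z n))\<^sup>2) \<longlonglongrightarrow> indicator {0..} l * 1\<^sup>2"
        by (intro tendsto_mult tendsto_const tendsto_power filterlim_compose[OF _ z_lim])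
      then show "(\<lambda>n. \<xi> l * ?k n l) \<longlonglongrightarrow> \<xi> l * indicator {0..} l"
        by (intro tendsto_mult tendsto_const) (simp add: power_divide mult.commute)
    qed
  qed
  moreover have "(LINT l|lebesgue. \<xi> l * ?k n l) = (norm (z n *\<^sub>R ?R n))\<^sup>2 / pert_det (z n)" for n
  proof -
    have "(LINT l|lebesgue. \<xi> l * ?k n l)
        = (LINT l|lebesgue. (z n)\<^sup>2 * (\<xi> l * (indicator {0..} l / (l + z n)\<^sup>2)))"
      by (simp add: mult_ac)
    also have "\<dots> = (z n)\<^sup>2 * ((norm (?R n))\<^sup>2 / pert_det (z n))"
      by (simp only: integral_mult_right_zero set_integral_eq[symmetric] integral_inverse_square[OF z])
    finally show ?thesis by (simp add: power_mult_distrib)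
  qed
  moreover have "(\<lambda>n. (norm (z n *\<^sub>R ?R n))\<^sup>2 / pert_det (z n)) \<longlonglongrightarrow> (norm a)\<^sup>2 / 1"
  proof (intro tendsto_divide tendsto_power tendsto_norm filterlim_compose[OF pert_det_tendsto z_lim])
    show "(\<lambda>n. z n *\<^sub>R ?R n) \<longlonglongrightarrow> a"
    proof (rule LIM_zero_cancel, rule Lim_null_comparison[OF always_eventually])
      show "\<forall>n. norm (z n *\<^sub>R ?R n - a) \<le> norm B * norm a / z n"
      proof
        fix n
        \<comment> \<open>The resolvent equation rewrites the error as an operator applied to the
          resolvent, which is of order \<open>1 / z n\<close>.\<close>
        have "z n *\<^sub>R ?R n - a = - B (?R n)"
          using B.resolvent_cancel(2)[OF z, of n a] by (metis add.commute minus_diff_eq add_diff_cancel_right')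
        then have "norm (z n *\<^sub>R ?R n - a) \<le> norm B * norm (?R n)"
          using norm_blinfun[of B "?R n"] by (simp only: norm_minus_cancel)
        also have "\<dots> \<le> norm B * (norm a / z n)"
          by (intro mult_left_mono B.norm_resolvent_le z) simp
        finally show "norm (z n *\<^sub>R ?R n - a) \<le> norm B * norm a / z n" by simp
      qed
      show "(\<lambda>n. norm B * norm a / z n) \<longlonglongrightarrow> 0"
        by (rule filterlim_compose[OF const_over_tendsto_0 z_lim])
    qed
  qed simp
  ultimately have "(LINT l|lebesgue. \<xi> l * indicator {0..} l) = (norm a)\<^sup>2"
    by (simp add: LIMSEQ_unique)
  then show ?thesis by (simp add: set_lebesgue_integral_def mult.commute)
qed

end

theorem theorem3p1:
  fixes \<alpha> :: "nat \<Rightarrow> real" and \<xi> :: "real \<Rightarrow> real"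
  assumes "\<alpha> \<in> ell1_weak_pp"
    and "is_hankel_ssf \<xi> \<alpha>"
  shows "(\<lambda>n. (\<alpha> n)\<^sup>2) sums (LINT l:{0..}|lebesgue. \<xi> l) \<and>
    set_integrable lebesgue {0..} (\<lambda>t. 1 - exp (- (LINT l:{0..}|lebesgue. \<xi> l / (l + t\<^sup>2)))) \<and>
    2 / pi * (LINT t:{0..}|lebesgue. 1 - exp (- (LINT l:{0..}|lebesgue. \<xi> l / (l + t\<^sup>2)))) = \<alpha> 0"
proof -
  have \<alpha>: "\<alpha> \<in> ell1_weak" and pos: "positive_form (hankel \<alpha>)"
    using assms(1) by (auto simp: ell1_weak_pp_def)
  interpret hankel_ssf \<alpha> \<xi> by standard (rule \<alpha>, rule assms(2))
  interpret \<Gamma>: positive_op "hankel \<alpha>"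
    by standard (rule symmetric_op_hankel[OF \<alpha>], rule positive_form_inner_nonneg[OF pos])
  have norm_nth: "(norm (ell2_nth a n))\<^sup>2 = (\<alpha> n)\<^sup>2" for n
    by (simp add: hankel_basis_0[OF \<alpha>])
  have 1: "(\<lambda>n. (\<alpha> n)\<^sup>2) sums (LINT l:{0..}|lebesgue. \<xi> l)"
    using summable_sums[OF summable_ell2[of a]] unfolding norm_nth integral_\<xi> norm_ell2_sq by simp
  let ?f = "\<lambda>t. inner (resolvent (t\<^sup>2) B a) a"
    and ?g = "\<lambda>t. 1 - exp (- (LINT l:{0..}|lebesgue. \<xi> l / (l + t\<^sup>2)))"
  \<comment> \<open>Restricted to \<open>t > 0\<close> because the determinant identity is available
    only for positive arguments.\<close>
  have fg: "?g t = ?f t" if "t > 0" for t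
    using pert_det_eq_exp[of "t\<^sup>2"] that by (simp add: pert_det_def log_det_def)
  note f_int = \<Gamma>.integral_resolvent_square[of "ell2_basis 0"]
  \<comment> \<open>The value at \<open>t = 0\<close>, whatever it is, is split off as a multiple of
    the indicator of a null set.\<close>
  have g_ind: "indicator {0..} t *\<^sub>R ?g t = indicator {0<..} t *\<^sub>R ?f t + indicator {0} t *\<^sub>R ?g 0" for t :: real
    using fg[of t] by (auto simp: indicator_def)
  have f_leb: "integrable lebesgue (\<lambda>t. indicator {0<..} t *\<^sub>R ?f t)"
      "(LINT t|lebesgue. indicator {0<..} t *\<^sub>R ?f t) = pi / 2 * \<alpha> 0"
  proof -
    \<comment> \<open>Measurability for \<open>lborel\<close> lets both integrability and the value
      pass to its completion.\<close>
    have m: "(\<lambda>t. indicator {0<..} t *\<^sub>R ?f t) \<in> borel_measurable lborel"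
      using f_int(1) unfolding set_integrable_def by (rule borel_measurable_integrable)
    show "integrable lebesgue (\<lambda>t. indicator {0<..} t *\<^sub>R ?f t)"
      using f_int(1) integrable_completion[OF m] unfolding set_integrable_def by simp
    have "inner a (ell2_basis 0) = \<alpha> 0"
      by (simp add: inner_ell2_basis hankel_basis_0[OF \<alpha>])
    then show "(LINT t|lebesgue. indicator {0<..} t *\<^sub>R ?f t) = pi / 2 * \<alpha> 0"
      using f_int(2) integral_completion[OF m] unfolding set_lebesgue_integral_def by simp
  qed
  have pt: "integrable lebesgue (\<lambda>t. indicator {0} t *\<^sub>R ?g 0)"
      "(LINT t|lebesgue. indicator {0} t *\<^sub>R ?g 0) = 0"
    by (simp_all add: integrable_scaleR_left)
  have 2: "set_integrable lebesgue {0..} ?g"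
    unfolding set_integrable_def g_ind by (intro Bochner_Integration.integrable_add f_leb pt)
  have "(LINT t:{0..}|lebesgue. ?g t) = pi / 2 * \<alpha> 0"
    unfolding set_lebesgue_integral_def[of lebesgue "{0..}" ?g] g_ind
      Bochner_Integration.integral_add[OF f_leb(1) pt(1)] f_leb(2) pt(2) by simp
  then have 3: "2 / pi * (LINT t:{0..}|lebesgue. ?g t) = \<alpha> 0" by (simp only:) simp
  from 1 2 3 show ?thesis by blast
qed

end
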